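(* Let $P$ be a Coxeter polyhedron in $H^n$ and let $w$ be a doubling wall of $P$. Then the double of $P$ across $w$ is a Coxeter polyhedron. If moreover $w$ is disjoint from another doubling wall of $P$ (so that $P$ is redoublable), then the double of $P$ across $w$ is also redoublable.
   Context: $H^n$ denotes real hyperbolic $n$-space. A Coxeter polyhedron in $H^n$ is a convex polyhedron (with nonempty interior) all of whose dihedral angles are integral submultiples of $\pi$ (i.e. $\pi/m$, $m\ge2$ an integer). A wall of a polyhedron is a codimension one face. Two walls meet if they have nonempty intersection in $H^n$ (sharing only an ideal point does not count as meeting); otherwise they are disjoint. A wall of a Coxeter polyhedron is a doubling wall if the angles it makes with the walls it meets are all even submultiples of $\pi$ (i.e. of the form $\pi/m$ with $m$ an even positive integer). The double of $P$ across one of its walls is the union of $P$ and its image under reflection across that wall. A polyhedron is redoublable if it is a Coxeter polyhedron with two doubling walls that do not meet each other in $H^n$. *)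

theory Defs
  imports "HOL-Analysis.Analysis"
begin

text \<open>
  Hyperbolic \<open>n\<close>-space is the upper sheet of the hyperboloid in Lorentzian space
  \<open>(real ^ 'n) \<times> real\<close>, where \<open>n = CARD('n)\<close>. The last coordinate is the timelike one.
\<close>

type_synonym 'n lorentz_space = "(real ^ 'n) \<times> real"

definition lorentz :: "'n::finite lorentz_space \<Rightarrow> 'n lorentz_space \<Rightarrow> real" where
  "lorentz x y = fst x \<bullet> fst y - snd x * snd y"

definition hyperbolic_space :: "'n::finite lorentz_space set" where
  "hyperbolic_space = {x. lorentz x x = -1 \<and> snd x > 0}"

text \<open>
  The hyperplanes of hyperbolic space are the sets \<open>lorentz x e = 0\<close> with \<open>e\<close> spacelike,
  normalised to \<open>lorentz e e = 1\<close>; then \<open>e\<close> points out of the following half-space.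
\<close>

definition halfspace :: "'n::finite lorentz_space \<Rightarrow> 'n lorentz_space set" where
  "halfspace e = {x \<in> hyperbolic_space. lorentz x e \<le> 0}"

definition reflection :: "'n::finite lorentz_space \<Rightarrow> 'n lorentz_space \<Rightarrow> 'n lorentz_space" where
  "reflection e x = x - (2 * lorentz x e) *\<^sub>R e"

definition hyp_polyhedron :: "'n::finite lorentz_space set \<Rightarrow> bool" where
  "hyp_polyhedron P \<longleftrightarrow>
     (\<exists>E. finite E \<and> (\<forall>e\<in>E. lorentz e e = 1) \<and> P = hyperbolic_space \<inter> (\<Inter>e\<in>E. halfspace e)) \<and>
     top_of_set hyperbolic_space interior_of P \<noteq> {}"

definition is_outward_normal ::
  "'n::finite lorentz_space set \<Rightarrow> 'n lorentz_space set \<Rightarrow> 'n lorentz_space \<Rightarrow> bool" where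
  "is_outward_normal P F e \<longleftrightarrow>
     lorentz e e = 1 \<and> P \<subseteq> halfspace e \<and> F = {x \<in> P. lorentz x e = 0}"

text \<open>
  A nonempty convex set in hyperbolic space that spans a linear subspace of dimension \<open>d + 1\<close>
  has hyperbolic dimension \<open>d\<close>, so codimension one is expressed by \<open>dim F = n\<close>.
\<close>

definition wall :: "'n::finite lorentz_space set \<Rightarrow> 'n lorentz_space set \<Rightarrow> bool" where
  "wall P F \<longleftrightarrow> (\<exists>e. is_outward_normal P F e) \<and> F \<noteq> {} \<and> dim F = CARD('n)"

lemma is_outward_normal_unique:
  fixes P F :: "'n::finite lorentz_space set"
  assumes P: "hyp_polyhedron P" and F: "wall P F"
    and e: "is_outward_normal P F e" and f: "is_outward_normal P F f"
  shows "e = f"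
proof -
  define J :: "'n lorentz_space \<Rightarrow> 'n lorentz_space" where "J x = (fst x, - snd x)" for x
  have LJ: "lorentz x y = J y \<bullet> x" for x y :: "'n lorentz_space"
    by (simp add: lorentz_def J_def inner_prod_def inner_commute mult.commute)
  have sp: "span F = {x. J a \<bullet> x = 0}" and nz: "J a \<noteq> 0" if a: "is_outward_normal P F a" for a
  proof -
    have "lorentz a a = 1" using a by (simp add: is_outward_normal_def)
    then show nz: "J a \<noteq> 0"
      by (auto simp: LJ)
    have "F \<subseteq> {x. J a \<bullet> x = 0}"
      using a by (auto simp: is_outward_normal_def LJ)
    then have sub: "span F \<subseteq> {x. J a \<bullet> x = 0}"
      by (simp add: span_minimal subspace_hyperplane)
    have "dim {x. J a \<bullet> x = 0} = CARD('n)"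
      using dim_hyperplane[OF nz] by simp
    then show "span F = {x. J a \<bullet> x = 0}"
      using sub F by (intro subspace_dim_equal) (auto simp: wall_def subspace_hyperplane)
  qed
  define c where "c = (J f \<bullet> J e) / (J e \<bullet> J e)"
  define g where "g = J f - c *\<^sub>R J e"
  have "J e \<bullet> g = 0"
    using nz[OF e] by (simp add: g_def c_def inner_diff_right inner_commute)
  then have "J f \<bullet> g = 0"
    using sp[OF e] sp[OF f] by blast
  with \<open>J e \<bullet> g = 0\<close> have "g \<bullet> g = 0"
    by (metis g_def inner_diff_left inner_scaleR_left mult_zero_right diff_0_right)
  then have "J f = c *\<^sub>R J e"
    by (simp add: g_def)
  then have fe: "f = c *\<^sub>R e"
    by (auto simp: J_def prod_eq_iff)
  have "lorentz f f = c\<^sup>2 * lorentz e e"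
    by (simp add: fe lorentz_def power2_eq_square algebra_simps)
  then have "c\<^sup>2 = 1"
    using e f by (simp add: is_outward_normal_def)
  then consider "c = 1" | "c = -1"
    by (auto simp: power2_eq_1_iff)
  then show ?thesis
  proof cases
    case 1
    then show ?thesis using fe by simp
  next
    case 2
    have ee: "lorentz e e = 1"
      using e by (simp add: is_outward_normal_def)
    have Pe: "lorentz x e = 0" if "x \<in> P" for x
    proof -
      have "lorentz x e \<le> 0" "lorentz x f \<le> 0"
        using that e f by (auto simp: is_outward_normal_def halfspace_def)
      then show ?thesis
        by (simp add: fe 2 lorentz_def)
    qed
    obtain x where "x \<in> top_of_set hyperbolic_space interior_of P"
      using P by (auto simp: hyp_polyhedron_def)
    then obtain T where T: "open T" "x \<in> T" "hyperbolic_space \<inter> T \<subseteq> P" "x \<in> hyperbolic_space"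
      by (auto simp: interior_of_def openin_open)
    then have xe: "lorentz x e = 0"
      using Pe by blast
    have xx: "lorentz x x = -1" "snd x > 0"
      using T by (auto simp: hyperbolic_space_def)
    define y where "y t = (1 / sqrt (1 - t\<^sup>2)) *\<^sub>R (x + t *\<^sub>R e)" for t
    have "(y \<longlongrightarrow> (1 / sqrt (1 - 0\<^sup>2)) *\<^sub>R (x + 0 *\<^sub>R e)) (at_right 0)"
      unfolding y_def by (intro tendsto_intros) auto
    then have lim: "(y \<longlongrightarrow> x) (at_right 0)"
      by simp
    have "eventually (\<lambda>t. y t \<in> T) (at_right 0)"
      using lim T topological_tendstoD by blast
    moreover have "eventually (\<lambda>t. snd (y t) > 0) (at_right 0)"
      using tendsto_snd[OF lim] xx(2) by (rule order_tendstoD)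
    moreover have "eventually (\<lambda>t. t \<in> {0<..<1}) (at_right (0::real))"
      by (rule eventually_at_right_real) simp
    ultimately have "eventually (\<lambda>t. y t \<in> T \<and> snd (y t) > 0 \<and> t \<in> {0<..<1}) (at_right 0)"
      by eventually_elim auto
    then obtain t where t: "y t \<in> T" "snd (y t) > 0" "0 < t" "t < 1"
      using eventually_happens'[OF trivial_limit_at_right_real] by auto
    have pos: "1 - t\<^sup>2 > 0"
      using t by (simp add: power_less_one_iff abs_square_less_1)
    have "lorentz (y t) (y t) =
        (1 / sqrt (1 - t\<^sup>2))\<^sup>2 * (lorentz x x + 2 * t * lorentz x e + t\<^sup>2 * lorentz e e)"
      by (simp add: y_def lorentz_def power2_eq_square inner_add_left inner_add_right
          inner_commute algebra_simps)
    also have "\<dots> = -1"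
      using pos by (simp add: xx xe ee power_divide field_simps)
    finally have "y t \<in> P"
      using T t by (auto simp: hyperbolic_space_def)
    have "lorentz (y t) e = (1 / sqrt (1 - t\<^sup>2)) * (lorentz x e + t * lorentz e e)"
      by (simp add: y_def lorentz_def inner_add_left algebra_simps)
    then have "lorentz (y t) e \<noteq> 0"
      using pos t by (simp add: xe ee)
    with Pe[OF \<open>y t \<in> P\<close>] show ?thesis
      by simp
  qed
qed

definition outward_normal ::
  "'n::finite lorentz_space set \<Rightarrow> 'n lorentz_space set \<Rightarrow> 'n lorentz_space" where
  "outward_normal P F = (THE e. is_outward_normal P F e)"

definition meets :: "'a set \<Rightarrow> 'a set \<Rightarrow> bool" where
  "meets F G \<longleftrightarrow> F \<inter> G \<noteq> {}"

text \<open>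
  If \<open>F\<close> and \<open>G\<close> meet at \<open>x\<close>, their outward normals are unit vectors in the tangent space at \<open>x\<close>,
  the Lorentz-orthogonal complement of \<open>x\<close>, on which \<open>lorentz\<close> is the Riemannian metric. The
  interior angle is the supplement of the angle between the outward normals.
\<close>

definition wall_angle ::
  "'n::finite lorentz_space set \<Rightarrow> 'n lorentz_space set \<Rightarrow> 'n lorentz_space set \<Rightarrow> real" where
  "wall_angle P F G = pi - arccos (lorentz (outward_normal P F) (outward_normal P G))"

text \<open>Dihedral angles live at codimension two faces, the intersections of adjacent walls.\<close>

definition adjacent_walls ::
  "'n::finite lorentz_space set \<Rightarrow> 'n lorentz_space set \<Rightarrow> 'n lorentz_space set \<Rightarrow> bool" where
  "adjacent_walls P F G \<longleftrightarrow>
     wall P F \<and> wall P G \<and> F \<noteq> G \<and> F \<inter> G \<noteq> {} \<and> Suc (dim (F \<inter> G)) = CARD('n)"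

definition coxeter_polyhedron :: "'n::finite lorentz_space set \<Rightarrow> bool" where
  "coxeter_polyhedron P \<longleftrightarrow>
     hyp_polyhedron P \<and>
     (\<forall>F G. adjacent_walls P F G \<longrightarrow> (\<exists>m::nat. m \<ge> 2 \<and> wall_angle P F G = pi / real m))"

definition doubling_wall :: "'n::finite lorentz_space set \<Rightarrow> 'n lorentz_space set \<Rightarrow> bool" where
  "doubling_wall P w \<longleftrightarrow>
     wall P w \<and>
     (\<forall>F. wall P F \<and> F \<noteq> w \<and> meets w F \<longrightarrow>
        (\<exists>m::nat. m > 0 \<and> even m \<and> wall_angle P w F = pi / real m))"

definition double ::
  "'n::finite lorentz_space set \<Rightarrow> 'n lorentz_space set \<Rightarrow> 'n lorentz_space set" where
  "double P w = P \<union> reflection (outward_normal P w) ` P"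

definition redoublable :: "'n::finite lorentz_space set \<Rightarrow> bool" where
  "redoublable P \<longleftrightarrow>
     coxeter_polyhedron P \<and>
     (\<exists>v w. v \<noteq> w \<and> doubling_wall P v \<and> doubling_wall P w \<and> \<not> meets v w)"

end

theory Submission
  imports Defs
begin

text \<open>
  Let \<open>w\<close> be the outward normal of the doubling wall, \<open>r\<close> the reflection across it and
  \<open>D = P \<union> r P\<close>. Everything is phrased through the finite set of outward unit normals of the
  walls of \<open>P\<close>. Two facts about an arbitrary polyhedron with nonempty interior carry the argument:
  it is the intersection of the half-spaces of its wall normals, and every wall normal
  occurs among the normals of any finite presentation by half-spaces
  (\<open>region_wall_normals\<close>, \<open>wall_normals_subset\<close>).

  The evenness of the angles at the doubling wall first enters as an inequality:
  \<open>lorentz w f \<le> 0\<close> for \<^emph>\<open>every\<close> other wall normal \<open>f\<close>. For walls meeting the doubling wall this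
  says that the angle is at most \<open>pi / 2\<close>. For the others it is the global part of the proof
  (\<open>disjoint_neg\<close>): as all walls meeting the doubling wall make nonobtuse angles with it,
  the orthogonal projection of \<open>P\<close> to the hyperplane of \<open>w\<close> stays inside the doubling wall, and
  if \<open>lorentz w f \<ge> 0\<close>, it would push a point of the wall of \<open>f\<close> onto or beyond the hyperplane
  of \<open>f\<close>, so the doubling wall would meet that of \<open>f\<close>. The inequality makes \<open>D\<close> convex: it is
  cut out by the half-spaces of \<open>f\<close> and \<open>r f\<close> with \<open>f \<noteq> w\<close> (\<open>D_region\<close>), so these are the only candidates for wall normals of \<open>D\<close>.

  For two adjacent walls of \<open>D\<close> there are then two possibilities. If their normals can be taken
  on the same side of the mirror, then the corresponding walls of \<open>P\<close> are already adjacent and the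
  angle is unchanged (\<open>adjacent_same_side\<close>). Otherwise their common face lies on the mirror;
  since three distinct walls of a polyhedron never share a codimension two face
  (\<open>three_walls_dim\<close>), the two normals must be \<open>e\<close> and \<open>r e\<close> for a single wall of \<open>P\<close>, and the
  angle is twice \<open>pi / m\<close> with \<open>m\<close> even and greater than two, hence again a submultiple of \<open>pi\<close>
  (\<open>half_angle\<close>).

  If \<open>v\<close> is the normal of a second doubling wall which misses the first, that wall and its mirror image are
  disjoint doubling walls of \<open>D\<close>: neither touches the mirror, so near each of them \<open>D\<close> looks like
  \<open>P\<close> or its reflection, and all angles along them are inherited (\<open>redoublable_D\<close>).
\<close>

section \<open>Lorentzian linear algebra\<close>

lemma lorentz_commute: "lorentz x y = lorentz y x"
  by (simp add: lorentz_def inner_commute mult.commute)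

lemma lorentz_add_left: "lorentz (x + y) z = lorentz x z + lorentz y z"
  by (simp add: lorentz_def inner_add_left algebra_simps)

lemma lorentz_scale_left: "lorentz (c *\<^sub>R x) z = c * lorentz x z"
  by (simp add: lorentz_def algebra_simps)

lemma lorentz_diff_left: "lorentz (x - y) z = lorentz x z - lorentz y z"
  by (simp add: lorentz_def inner_diff_left algebra_simps)

lemma lorentz_add_right: "lorentz z (x + y) = lorentz z x + lorentz z y"
  by (simp add: lorentz_def inner_add_right algebra_simps)

lemma lorentz_scale_right: "lorentz z (c *\<^sub>R x) = c * lorentz z x"
  by (simp add: lorentz_def algebra_simps)

lemma lorentz_diff_right: "lorentz z (x - y) = lorentz z x - lorentz z y"
  by (simp add: lorentz_def inner_diff_right algebra_simps)

lemma lorentz_minus_right: "lorentz z (- x) = - lorentz z x"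
  by (simp add: lorentz_def)

lemma lorentz_zero [simp]: "lorentz x 0 = 0" "lorentz 0 x = 0"
  by (simp_all add: lorentz_def)

lemmas lorentz_linear =
  lorentz_add_left lorentz_scale_left lorentz_diff_left
  lorentz_add_right lorentz_scale_right lorentz_diff_right lorentz_minus_right

text \<open>
  The Lorentz form is the Euclidean inner product twisted by this involution, which transfers
  Euclidean facts about dimensions of hyperplanes and orthogonal complements.
\<close>

definition time_flip :: "'n::finite lorentz_space \<Rightarrow> 'n lorentz_space" where
  "time_flip x = (fst x, - snd x)"

lemma lorentz_eq_inner: "lorentz x y = time_flip y \<bullet> x"
  by (simp add: lorentz_def time_flip_def inner_prod_def inner_commute mult.commute)

lemma linear_time_flip: "linear time_flip"
  by (rule linearI) (auto simp: time_flip_def)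

lemma inj_time_flip: "inj time_flip"
  by (rule injI) (auto simp: time_flip_def prod_eq_iff)

lemma subspace_lorentz_hyperplane: "subspace {x. lorentz x e = 0}"
  by (simp add: lorentz_eq_inner subspace_hyperplane)

lemma lorentz_span_zero:
  assumes "\<And>y. y \<in> S \<Longrightarrow> lorentz y e = 0" and "x \<in> span S"
  shows "lorentz x e = 0"
proof -
  have "span S \<subseteq> {x. lorentz x e = 0}"
    using assms(1) by (intro span_minimal subspace_lorentz_hyperplane) auto
  then show ?thesis
    using assms(2) by auto
qed

lemma dim_lorentz_hyperplane:
  fixes e :: "'n::finite lorentz_space"
  assumes "e \<noteq> 0"
  shows "dim {x. lorentz x e = 0} = CARD('n)"
proof -
  have "time_flip e \<noteq> 0"
    using assms by (auto simp: time_flip_def prod_eq_iff)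
  then show ?thesis
    using dim_hyperplane[of "time_flip e"] by (simp add: lorentz_eq_inner)
qed

lemma lorentz_nondegenerate:
  assumes "\<And>x. lorentz x e = 0"
  shows "e = 0"
proof -
  have "time_flip e = 0"
    using assms[of "time_flip e"] by (simp add: lorentz_eq_inner)
  then show ?thesis
    by (auto simp: time_flip_def prod_eq_iff)
qed

text \<open>
  A set of full dimension in a hyperplane spans it, so its annihilator is a line; on that line
  there are only two unit vectors.
\<close>

lemma common_hyperplane_normals:
  fixes S :: "'n::finite lorentz_space set"
  assumes S: "dim S = CARD('n)"
    and e: "lorentz e e = 1" "\<And>x. x \<in> S \<Longrightarrow> lorentz x e = 0"
    and f: "lorentz f f = 1" "\<And>x. x \<in> S \<Longrightarrow> lorentz x f = 0"
  shows "f = e \<or> f = - e"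
proof -
  have "e \<noteq> 0" using e by auto
  have sub: "span S \<subseteq> {x. lorentz x e = 0}"
    using e(2) by (intro span_minimal subspace_lorentz_hyperplane) auto
  have span: "span S = {x. lorentz x e = 0}"
    using S dim_lorentz_hyperplane[OF \<open>e \<noteq> 0\<close>] sub
    by (intro subspace_dim_equal) (auto simp: subspace_lorentz_hyperplane)
  have "f - lorentz f e *\<^sub>R e = 0"
  proof (rule lorentz_nondegenerate)
    fix x
    have "x - lorentz x e *\<^sub>R e \<in> span S"
      by (simp add: span lorentz_linear e)
    then have "lorentz (x - lorentz x e *\<^sub>R e) f = 0"
      using f(2) by (rule lorentz_span_zero[rotated])
    then show "lorentz x (f - lorentz f e *\<^sub>R e) = 0"
      by (simp add: lorentz_linear lorentz_commute)
  qed
  then have fe: "f = lorentz f e *\<^sub>R e" by simp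
  then have "lorentz f f = (lorentz f e)\<^sup>2"
    by (metis lorentz_scale_right power2_eq_square)
  then have "lorentz f e = 1 \<or> lorentz f e = - 1"
    using f(1) by (simp add: power2_eq_1_iff)
  then show ?thesis
    using fe by auto
qed

text \<open>
  A set annihilated by three independent vectors spans at most a codimension three subspace of the
  ambient space, whose dimension is \<open>CARD('n) + 1\<close>.
\<close>

lemma dim_orthogonal_independent_triple:
  fixes S :: "'n::finite lorentz_space set"
  assumes S: "\<And>x. x \<in> S \<Longrightarrow> lorentz x e = 0 \<and> lorentz x f = 0 \<and> lorentz x g = 0"
    and ind: "independent {e, f, g}" and card: "card {e, f, g} = 3"
  shows "dim S + 2 \<le> CARD('n)"
proof -
  let ?A = "time_flip ` {e, f, g}"
  have "dim ?A = dim {e, f, g}"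
    using dim_image_eq[OF linear_time_flip] inj_time_flip
    by (metis inj_on_subset subset_UNIV)
  then have "dim ?A = 3"
    using ind card by (simp add: dim_eq_card_independent)
  moreover have "dim {y \<in> UNIV. \<forall>x\<in>span ?A. orthogonal x y} + dim (span ?A) =
      dim (UNIV :: 'n lorentz_space set)"
    by (intro dim_subspace_orthogonal_to_vectors) auto
  moreover have "dim S \<le> dim {y \<in> UNIV. \<forall>x\<in>span ?A. orthogonal x y}"
  proof (intro dim_subset subsetI CollectI conjI ballI UNIV_I)
    fix y x
    assume "y \<in> S" "x \<in> span ?A"
    then have "orthogonal y x"
      using S[of y]
      by (intro orthogonal_to_span[of x ?A])
        (auto simp: orthogonal_def lorentz_eq_inner inner_commute)
    then show "orthogonal x y" by (simp add: orthogonal_commute)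
  qed
  ultimately show ?thesis by simp
qed

section \<open>The forward light cone\<close>

text \<open>
  This is the set of future-directed timelike vectors. Working in this open convex cone instead of the
  hyperboloid replaces geodesics by straight segments: a condition that is homogeneous in \<open>x\<close> can be
  checked before normalising.
\<close>

definition forward_cone :: "'n::finite lorentz_space set" where
  "forward_cone = {x. norm (fst x) < snd x}"

lemma forward_cone_iff: "x \<in> forward_cone \<longleftrightarrow> lorentz x x < 0 \<and> 0 < snd x"
proof -
  have "lorentz x x < 0 \<longleftrightarrow> (norm (fst x))\<^sup>2 < (snd x)\<^sup>2"
    by (simp add: lorentz_def power2_norm_eq_inner power2_eq_square[of "snd x"])
  then show ?thesis
    unfolding forward_cone_def mem_Collect_eq
    by (smt (verit) norm_ge_zero power_less_imp_less_base power_strict_mono zero_less_numeral)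
qed

lemma open_forward_cone: "open (forward_cone :: 'n::finite lorentz_space set)"
  unfolding forward_cone_def by (intro open_Collect_less continuous_intros)

lemma hyperbolic_subset_forward_cone: "x \<in> hyperbolic_space \<Longrightarrow> x \<in> forward_cone"
  by (simp add: hyperbolic_space_def forward_cone_iff)

lemma forward_cone_scale: "x \<in> forward_cone \<Longrightarrow> 0 < c \<Longrightarrow> c *\<^sub>R x \<in> forward_cone"
  by (simp add: forward_cone_def)

lemma forward_cone_add: "x \<in> forward_cone \<Longrightarrow> y \<in> forward_cone \<Longrightarrow> x + y \<in> forward_cone"
  unfolding forward_cone_def mem_Collect_eq fst_add snd_add
  by (rule le_less_trans[OF norm_triangle_ineq]) simp

lemma forward_cone_add_scale:
  "x \<in> forward_cone \<Longrightarrow> y \<in> forward_cone \<Longrightarrow> 0 \<le> c \<Longrightarrow> x + c *\<^sub>R y \<in> forward_cone"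
  by (cases "c = 0") (simp_all add: forward_cone_add forward_cone_scale)

text \<open>
  The reversed Cauchy-Schwarz inequality, in the weak form which separates the two sheets.
\<close>

lemma forward_cone_lorentz_neg:
  assumes "x \<in> forward_cone" "y \<in> forward_cone"
  shows "lorentz x y < 0"
proof -
  have "norm (fst x) * norm (fst y) < snd x * snd y"
    using assms by (intro mult_strict_mono') (auto simp: forward_cone_def)
  then show ?thesis
    using norm_cauchy_schwarz[of "fst x" "fst y"] by (simp add: lorentz_def)
qed

lemma timelike_cases:
  assumes "lorentz u u < 0"
  shows "u \<in> forward_cone \<or> - u \<in> forward_cone"
proof -
  have "snd u \<noteq> 0"
  proof
    assume "snd u = 0"
    then have "fst u \<bullet> fst u < 0" using assms by (simp add: lorentz_def)
    then show False using inner_ge_zero[of "fst u"] by linarith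
  qed
  then show ?thesis
    using assms by (auto simp: forward_cone_iff lorentz_def)
qed

text \<open>
  The tangent space of the hyperboloid at \<open>x\<close> is Riemannian: a timelike \<open>u\<close> would lie, up to sign, in
  the forward cone and then could not be orthogonal to \<open>x\<close>.
\<close>

lemma tangent_nonneg:
  assumes "x \<in> forward_cone" "lorentz x u = 0"
  shows "0 \<le> lorentz u u"
proof (rule ccontr)
  assume "\<not> 0 \<le> lorentz u u"
  then have "u \<in> forward_cone \<or> - u \<in> forward_cone"
    by (intro timelike_cases) simp
  then have "lorentz x u < 0 \<or> lorentz x (- u) < 0"
    by (elim disj_forward forward_cone_lorentz_neg[OF assms(1)])
  then show False
    using assms(2) by (simp add: lorentz_minus_right)
qed

text \<open>
  Cauchy-Schwarz in the tangent space at a common point of two hyperplanes. It is what makes \<open>arccos\<close> in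
  the definition of the angle meaningful.
\<close>

lemma tangent_unit_bound:
  assumes x: "x \<in> forward_cone" "lorentz x e = 0" "lorentz x f = 0"
    and unit: "lorentz e e = 1" "lorentz f f = 1"
  shows "\<bar>lorentz e f\<bar> \<le> 1"
proof -
  have "0 \<le> lorentz (e + f) (e + f)" "0 \<le> lorentz (e - f) (e - f)"
    using x by (intro tangent_nonneg[of x]; simp add: lorentz_linear)+
  then show ?thesis
    using unit by (simp add: lorentz_linear lorentz_commute[of f e] abs_le_iff)
qed

definition normalise :: "'n::finite lorentz_space \<Rightarrow> 'n lorentz_space" where
  "normalise x = (1 / sqrt (- lorentz x x)) *\<^sub>R x"

lemma normalise_in_hyperbolic: "x \<in> forward_cone \<Longrightarrow> normalise x \<in> hyperbolic_space"
  by (auto simp: normalise_def hyperbolic_space_def forward_cone_iff lorentz_linear divide_simps)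

lemma normalise_scale:
  assumes "x \<in> forward_cone"
  obtains c where "0 < c" "normalise x = c *\<^sub>R x"
  using assms by (intro that[of "1 / sqrt (- lorentz x x)"]) (auto simp: normalise_def forward_cone_iff)

lemma lorentz_normalise_sign:
  assumes "x \<in> forward_cone"
  shows "lorentz (normalise x) e \<le> 0 \<longleftrightarrow> lorentz x e \<le> 0"
    and "lorentz (normalise x) e = 0 \<longleftrightarrow> lorentz x e = 0"
proof -
  obtain c where "0 < c" "normalise x = c *\<^sub>R x"
    using assms by (rule normalise_scale)
  then show "lorentz (normalise x) e \<le> 0 \<longleftrightarrow> lorentz x e \<le> 0"
    and "lorentz (normalise x) e = 0 \<longleftrightarrow> lorentz x e = 0"
    by (auto simp: lorentz_scale_left mult_le_0_iff)
qed

lemma normalise_span: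
  assumes "x \<in> forward_cone" "normalise x \<in> S"
  shows "x \<in> span S"
proof -
  obtain c where c: "0 < c" "normalise x = c *\<^sub>R x"
    using assms(1) by (rule normalise_scale)
  then have "x = (1 / c) *\<^sub>R normalise x" by simp
  then show ?thesis
    by (metis assms(2) span_base span_scale)
qed

lemma normalise_hyperbolic: "x \<in> hyperbolic_space \<Longrightarrow> normalise x = x"
  by (simp add: normalise_def hyperbolic_space_def)

section \<open>Reflections\<close>

lemma linear_reflection: "linear (reflection e)"
  by (rule linearI) (auto simp: reflection_def lorentz_linear algebra_simps)

lemma reflection_fixed: "lorentz x e = 0 \<Longrightarrow> reflection e x = x"
  by (simp add: reflection_def)

context
  fixes e :: "'n::finite lorentz_space"
  assumes unit: "lorentz e e = 1"
begin

lemma reflection_involution: "reflection e (reflection e x) = x"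
  by (simp add: reflection_def lorentz_linear unit algebra_simps)

lemma lorentz_reflection_normal: "lorentz (reflection e x) e = - lorentz x e"
  by (simp add: reflection_def lorentz_linear unit)

lemma lorentz_reflection_left: "lorentz (reflection e x) y = lorentz x (reflection e y)"
  by (simp add: reflection_def lorentz_linear lorentz_commute)

lemma lorentz_reflection: "lorentz (reflection e x) (reflection e y) = lorentz x y"
  by (simp add: lorentz_reflection_left reflection_involution)

lemma inj_reflection: "inj (reflection e)"
  by (metis injI reflection_involution)

text \<open>
  The form is preserved; that the sheet is preserved too follows because \<open>x\<close> and the negative of its
  image have positive product, which two forward vectors never have.
\<close>

lemma reflection_hyperbolic:
  assumes x: "x \<in> hyperbolic_space"
  shows "reflection e x \<in> hyperbolic_space"
proof -
  let ?y = "reflection e x"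
  have xx: "lorentz x x = - 1" "x \<in> forward_cone"
    using x hyperbolic_subset_forward_cone[OF x] by (auto simp: hyperbolic_space_def)
  have yy: "lorentz ?y ?y = - 1"
    using xx by (simp add: lorentz_reflection)
  have "lorentz x (- ?y) = 1 + 2 * (lorentz x e)\<^sup>2"
    using xx by (simp add: reflection_def lorentz_linear power2_eq_square)
  then have "\<not> lorentz x (- ?y) < 0"
    by (smt (verit) zero_le_power2)
  then have "- ?y \<notin> forward_cone"
    by (elim contrapos_nn forward_cone_lorentz_neg[OF xx(2)])
  then have "?y \<in> forward_cone"
    using timelike_cases[of ?y] yy by simp
  then have "0 < snd ?y"
    by (simp add: forward_cone_iff)
  then show ?thesis
    using yy by (simp add: hyperbolic_space_def)
qed

end

section \<open>Walls and their normals\<close>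

text \<open>
  Walls are handled through their outward normals: the walls of \<open>P\<close> are the sets \<open>facet P e\<close> with
  \<open>e\<close> in \<open>wall_normals P\<close>, and on polyhedra this correspondence is bijective
  (\<open>wall_iff\<close>, \<open>facet_eq_iff\<close>).
\<close>

definition facet :: "'n::finite lorentz_space set \<Rightarrow> 'n lorentz_space \<Rightarrow> 'n lorentz_space set" where
  "facet P e = {x \<in> P. lorentz x e = 0}"

definition wall_normals :: "'n::finite lorentz_space set \<Rightarrow> 'n lorentz_space set" where
  "wall_normals P =
     {e. lorentz e e = 1 \<and> P \<subseteq> halfspace e \<and> facet P e \<noteq> {} \<and> dim (facet P e) = CARD('n)}"

definition region :: "'n::finite lorentz_space set \<Rightarrow> 'n lorentz_space set" where
  "region E = hyperbolic_space \<inter> (\<Inter>e\<in>E. halfspace e)"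

lemma region_iff: "x \<in> region E \<longleftrightarrow> x \<in> hyperbolic_space \<and> (\<forall>e\<in>E. lorentz x e \<le> 0)"
  by (auto simp: region_def halfspace_def)

lemma normalise_region:
  "x \<in> forward_cone \<Longrightarrow> (\<And>e. e \<in> E \<Longrightarrow> lorentz x e \<le> 0) \<Longrightarrow> normalise x \<in> region E"
  by (simp add: region_iff normalise_in_hyperbolic lorentz_normalise_sign)

lemma wall_iff: "wall P F \<longleftrightarrow> (\<exists>e\<in>wall_normals P. F = facet P e)"
  unfolding wall_def wall_normals_def is_outward_normal_def facet_def by blast

lemma is_outward_normal_facet: "e \<in> wall_normals P \<Longrightarrow> is_outward_normal P (facet P e) e"
  by (auto simp: wall_normals_def is_outward_normal_def facet_def)

lemma outward_normal_facet:
  assumes "hyp_polyhedron P" "e \<in> wall_normals P"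
  shows "outward_normal P (facet P e) = e"
proof -
  have w: "wall P (facet P e)" using assms(2) wall_iff by blast
  show ?thesis
    unfolding outward_normal_def
    by (intro the_equality is_outward_normal_facet is_outward_normal_unique[OF assms(1) w] assms(2))
qed

lemma facet_eq_iff:
  assumes "hyp_polyhedron P" "e \<in> wall_normals P" "f \<in> wall_normals P"
  shows "facet P e = facet P f \<longleftrightarrow> e = f"
  using assms outward_normal_facet by metis

lemma wall_normals_unit: "e \<in> wall_normals P \<Longrightarrow> lorentz e e = 1"
  by (simp add: wall_normals_def)

lemma wall_normals_nonpos: "e \<in> wall_normals P \<Longrightarrow> x \<in> P \<Longrightarrow> lorentz x e \<le> 0"
  by (auto simp: wall_normals_def halfspace_def)

lemma eventually_perturb:
  assumes x: "x \<in> forward_cone" and E: "finite E" "\<And>e. e \<in> E \<Longrightarrow> lorentz x e < 0"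
  shows "\<forall>\<^sub>F t in at_right 0. x + t *\<^sub>R u \<in> forward_cone \<and> (\<forall>e\<in>E. lorentz (x + t *\<^sub>R u) e < 0)"
proof (intro eventually_conj eventually_ball_finite E(1) ballI)
  have "((\<lambda>t. x + t *\<^sub>R u) \<longlongrightarrow> x + 0 *\<^sub>R u) (at_right 0)"
    by (intro tendsto_intros)
  then show "\<forall>\<^sub>F t in at_right 0. x + t *\<^sub>R u \<in> forward_cone"
    using open_forward_cone x by (auto dest: topological_tendstoD)
next
  fix e assume "e \<in> E"
  have "((\<lambda>t. lorentz x e + t * lorentz u e) \<longlongrightarrow> lorentz x e + 0 * lorentz u e) (at_right 0)"
    by (intro tendsto_intros)
  then show "\<forall>\<^sub>F t in at_right 0. lorentz (x + t *\<^sub>R u) e < 0"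
    using E(2)[OF \<open>e \<in> E\<close>] by (auto simp: lorentz_linear dest: order_tendstoD(2))
qed

lemma perturb:
  assumes x: "x \<in> forward_cone" and E: "finite E" "\<And>e. e \<in> E \<Longrightarrow> lorentz x e < 0"
  obtains t where "0 < t" "x + t *\<^sub>R u \<in> forward_cone" "\<And>e. e \<in> E \<Longrightarrow> lorentz (x + t *\<^sub>R u) e < 0"
proof -
  have "\<forall>\<^sub>F t in at_right (0::real). 0 < t"
    by (simp add: eventually_at_right_less)
  moreover have "\<forall>\<^sub>F t in at_right 0. x + t *\<^sub>R u \<in> forward_cone \<and>
      (\<forall>e\<in>E. lorentz (x + t *\<^sub>R u) e < 0)"
    using x E by (rule eventually_perturb)
  ultimately have "\<forall>\<^sub>F t in at_right 0. 0 < t \<and> x + t *\<^sub>R u \<in> forward_cone \<and>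
      (\<forall>e\<in>E. lorentz (x + t *\<^sub>R u) e < 0)"
    by eventually_elim auto
  then show ?thesis
    using eventually_happens'[OF trivial_limit_at_right_real] that by blast
qed

text \<open>
  If \<open>x\<close> lay on the hyperplane of \<open>e\<close>, moving it a little in the direction \<open>e\<close> would leave the
  half-space but not the interior.
\<close>

lemma lorentz_interior_neg:
  assumes x: "x \<in> top_of_set hyperbolic_space interior_of P"
    and e: "lorentz e e = 1" "P \<subseteq> halfspace e"
  shows "lorentz x e < 0"
proof (rule ccontr)
  assume "\<not> lorentz x e < 0"
  obtain T where T: "open T" "x \<in> T" "hyperbolic_space \<inter> T \<subseteq> P" "x \<in> hyperbolic_space"
    using x by (auto simp: interior_of_def openin_open)
  have xe: "lorentz x e \<ge> 0" using \<open>\<not> lorentz x e < 0\<close> by simp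
  have lxx: "lorentz x x = - 1"
    using T by (simp add: hyperbolic_space_def)
  have lim: "((\<lambda>t. x + t *\<^sub>R e) \<longlongrightarrow> x + 0 *\<^sub>R e) (at_right 0)"
    by (intro tendsto_intros)
  have "((\<lambda>t. normalise (x + t *\<^sub>R e)) \<longlongrightarrow> normalise (x + 0 *\<^sub>R e)) (at_right 0)"
    unfolding normalise_def lorentz_def by (intro tendsto_intros lim)
      (use lxx in \<open>simp add: lorentz_def\<close>)
  then have "((\<lambda>t. normalise (x + t *\<^sub>R e)) \<longlongrightarrow> x) (at_right 0)"
    using T(4) by (simp add: normalise_hyperbolic)
  then have "\<forall>\<^sub>F t in at_right 0. normalise (x + t *\<^sub>R e) \<in> T"
    using T by (auto dest: topological_tendstoD)
  moreover have "\<forall>\<^sub>F t in at_right 0. x + t *\<^sub>R e \<in> forward_cone"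
    using eventually_perturb[of x "{}" e] hyperbolic_subset_forward_cone[OF T(4)] by simp
  moreover have "\<forall>\<^sub>F t in at_right (0::real). 0 < t"
    by (simp add: eventually_at_right_less)
  ultimately have "\<forall>\<^sub>F t in at_right 0. normalise (x + t *\<^sub>R e) \<in> T \<and>
      x + t *\<^sub>R e \<in> forward_cone \<and> 0 < t"
    by eventually_elim auto
  then obtain t where t: "normalise (x + t *\<^sub>R e) \<in> T" "x + t *\<^sub>R e \<in> forward_cone" "0 < t"
    using eventually_happens'[OF trivial_limit_at_right_real] by blast
  then have "normalise (x + t *\<^sub>R e) \<in> P"
    using T normalise_in_hyperbolic by blast
  then have "lorentz (normalise (x + t *\<^sub>R e)) e \<le> 0"
    using e by (auto simp: halfspace_def)
  then have "lorentz x e + t \<le> 0"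
    using t by (simp add: lorentz_normalise_sign lorentz_linear e)
  then show False using xe t by simp
qed

lemma interior_point:
  assumes "hyp_polyhedron P"
  obtains p where "p \<in> hyperbolic_space"
    "\<And>e. lorentz e e = 1 \<Longrightarrow> P \<subseteq> halfspace e \<Longrightarrow> lorentz p e < 0"
proof -
  obtain p where "p \<in> top_of_set hyperbolic_space interior_of P"
    using assms by (auto simp: hyp_polyhedron_def)
  moreover from this have "p \<in> hyperbolic_space"
    by (auto simp: interior_of_def openin_open)
  ultimately show ?thesis
    using lorentz_interior_neg by (intro that)
qed

lemma wall_normals_halfspace: "e \<in> wall_normals P \<Longrightarrow> P \<subseteq> halfspace e"
  by (simp add: wall_normals_def)

text \<open>
  By the dimension of the facet only \<open>f = - e\<close> remains to be excluded, and an interior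
  point of \<open>P\<close> lies strictly on the inner side of both hyperplanes.
\<close>

lemma facet_determines_normal:
  assumes P: "hyp_polyhedron P" and e: "e \<in> wall_normals P"
    and f: "lorentz f f = 1" "P \<subseteq> halfspace f"
    and sub: "\<And>x. x \<in> facet P e \<Longrightarrow> lorentz x f = 0"
  shows "f = e"
proof -
  have "dim (facet P e) = CARD('a)"
    using e by (simp add: wall_normals_def)
  then have "f = e \<or> f = - e"
    by (rule common_hyperplane_normals)
      (use e f sub in \<open>simp_all only: wall_normals_unit facet_def mem_Collect_eq\<close>)
  moreover have "f \<noteq> - e"
  proof
    assume fe: "f = - e"
    obtain p where "p \<in> hyperbolic_space"
      and p: "\<And>e. lorentz e e = 1 \<Longrightarrow> P \<subseteq> halfspace e \<Longrightarrow> lorentz p e < 0"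
      by (rule interior_point[OF P]) (rule that)
    have "lorentz p e < 0" "lorentz p f < 0"
      using p[OF wall_normals_unit[OF e] wall_normals_halfspace[OF e]] p[OF f] .
    then show False by (simp add: fe lorentz_linear)
  qed
  ultimately show ?thesis by simp
qed

text \<open>
  Suppose no half-space of the presentation is tight along the whole facet. Adding up
  points of the facet, one for each half-space that is strict there, gives a point of the facet at
  which all inequalities are strict; a neighbourhood of it belongs to \<open>P\<close>, contradicting that the
  facet lies on the boundary of the half-space of \<open>e\<close>. So some \<open>f \<in> E\<close> vanishes on the
  facet, and then \<open>f = e\<close>.
\<close>

lemma wall_normals_subset:
  assumes P: "hyp_polyhedron P" "P = region E"
    and E: "finite E" "\<And>e. e \<in> E \<Longrightarrow> lorentz e e = 1"
  shows "wall_normals P \<subseteq> E"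
proof
  fix e assume e: "e \<in> wall_normals P"
  let ?F = "facet P e"
  have "\<exists>f\<in>E. \<forall>x\<in>?F. lorentz x f = 0"
  proof (rule ccontr)
    assume no: "\<not> ?thesis"
    have ex: "\<exists>x\<in>?F. lorentz x f < 0" if "f \<in> E" for f
    proof -
      have "\<not> (\<forall>x\<in>?F. lorentz x f = 0)"
      proof
        assume "\<forall>x\<in>?F. lorentz x f = 0"
        then have "\<exists>f\<in>E. \<forall>x\<in>?F. lorentz x f = 0"
          using that by (rule bexI)
        with no show False by contradiction
      qed
      then obtain x where x: "x \<in> ?F" "lorentz x f \<noteq> 0"
        by blast
      then have "x \<in> P" by (simp add: facet_def)
      then have "lorentz x f \<le> 0" using that unfolding P(2) region_iff by simp
      then show ?thesis using x by (intro bexI[of _ x]) auto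
    qed
    have "\<exists>z\<in>forward_cone. lorentz z e = 0 \<and> (\<forall>f\<in>E. lorentz z f \<le> 0) \<and> (\<forall>f\<in>A. lorentz z f < 0)"
      if "finite A" "A \<subseteq> E" for A
      using that
    proof (induction A)
      case empty
      have "?F \<noteq> {}" using e by (simp add: wall_normals_def)
      then obtain x where "x \<in> ?F" unfolding ex_in_conv[symmetric] by (elim exE)
      then show ?case
        unfolding P(2) by (intro bexI[of _ x])
          (simp_all add: facet_def region_iff hyperbolic_subset_forward_cone)
    next
      case (insert a A)
      have A: "a \<in> E" "A \<subseteq> E" using insert.prems by simp_all
      obtain z where z: "z \<in> forward_cone" "lorentz z e = 0" "\<And>f. f \<in> E \<Longrightarrow> lorentz z f \<le> 0"
        "\<And>f. f \<in> A \<Longrightarrow> lorentz z f < 0"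
        using insert.IH[OF A(2)] by (elim bexE conjE) (simp only: Ball_def)
      obtain x where x: "x \<in> ?F" "lorentz x a < 0"
        using ex[OF A(1)] by (elim bexE)
      then have xF: "x \<in> forward_cone" "lorentz x e = 0" "\<And>f. f \<in> E \<Longrightarrow> lorentz x f \<le> 0"
        unfolding P(2) by (simp_all add: facet_def region_iff hyperbolic_subset_forward_cone)
      have "lorentz (z + x) f \<le> 0" if "f \<in> E" for f
        using z(3)[OF that] xF(3)[OF that] by (simp add: lorentz_linear)
      moreover have "lorentz (z + x) f < 0" if "f \<in> insert a A" for f
      proof (cases "f = a")
        case True
        then show ?thesis
          using z(3)[OF A(1)] x(2) by (simp add: lorentz_linear)
      next
        case False
        then have "f \<in> A" using that by simp
        then have "f \<in> E" by (rule subsetD[OF A(2)])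
        then show ?thesis
          using z(4)[OF \<open>f \<in> A\<close>] xF(3)[of f] by (simp add: lorentz_linear)
      qed
      ultimately show ?case
        using z xF by (intro bexI[of _ "z + x"]) (simp_all add: lorentz_linear forward_cone_add)
    qed
    from this[OF E(1) subset_refl] obtain z where z: "z \<in> forward_cone" "lorentz z e = 0"
      "\<And>f. f \<in> E \<Longrightarrow> lorentz z f < 0" by blast
    (* Pushing z outwards along e keeps all strict inequalities of E but violates that of e. *)
    obtain t where t: "0 < t" "z + t *\<^sub>R e \<in> forward_cone"
      "\<And>f. f \<in> E \<Longrightarrow> lorentz (z + t *\<^sub>R e) f < 0"
      using perturb[OF z(1) E(1) z(3)] by blast
    then have "normalise (z + t *\<^sub>R e) \<in> P"
      unfolding P(2) by (intro normalise_region less_imp_le)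
    then have "lorentz (normalise (z + t *\<^sub>R e)) e \<le> 0"
      using e by (rule wall_normals_nonpos[rotated])
    then show False
      using t z wall_normals_unit[OF e] by (simp add: lorentz_normalise_sign lorentz_linear)
  qed
  then obtain f where f: "f \<in> E" "\<forall>x\<in>?F. lorentz x f = 0" by (elim bexE)
  have "P \<subseteq> halfspace f"
    using f(1) by (auto simp: P(2) region_def)
  then have "f = e"
    using f(2) by (intro facet_determines_normal[OF P(1) e E(2)[OF f(1)]]) simp_all
  then show "e \<in> E" using f by simp
qed

text \<open>
  In a presentation with as few half-spaces as possible every normal belongs to a wall. Dropping the normal \<open>e\<close>
  admits a new point \<open>x\<close>; the segment from an interior point \<open>p\<close> to \<open>x\<close> crosses the hyperplane
  of \<open>e\<close> at a point satisfying all other inequalities strictly, so that a whole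
  neighbourhood of it in this hyperplane belongs to the facet of \<open>e\<close>.
\<close>

lemma region_wall_normals:
  assumes P: "hyp_polyhedron P"
  shows "finite (wall_normals P)" "P = region (wall_normals P)"
proof -
  define good where "good E \<longleftrightarrow> finite E \<and> (\<forall>e\<in>E. lorentz e e = 1) \<and> P = region E" for E
  have "\<exists>E. good E"
    using P by (auto simp: hyp_polyhedron_def good_def region_def)
  then obtain E where E: "good E" and min: "\<And>E'. good E' \<Longrightarrow> card E \<le> card E'"
    using ex_has_least_nat[of good _ card] by blast
  have fin: "finite E" and unit: "\<And>e. e \<in> E \<Longrightarrow> lorentz e e = 1" and PE: "P = region E"
    using E by (auto simp: good_def)
  obtain p where p: "p \<in> hyperbolic_space"
    "\<And>e. lorentz e e = 1 \<Longrightarrow> P \<subseteq> halfspace e \<Longrightarrow> lorentz p e < 0"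
    by (rule interior_point[OF P]) (rule that)
  have half: "P \<subseteq> halfspace e" if "e \<in> E" for e
    using that by (auto simp: PE region_def)
  have "e \<in> wall_normals P" if e: "e \<in> E" for e
  proof -
    have "\<not> good (E - {e})"
      using min[of "E - {e}"] card_Diff1_less[OF fin e] by auto
    then have "P \<noteq> region (E - {e})"
      using fin unit by (auto simp: good_def)
    moreover have "P \<subseteq> region (E - {e})"
      by (auto simp: PE region_def)
    ultimately obtain x where x: "x \<in> hyperbolic_space" "\<And>f. f \<in> E - {e} \<Longrightarrow> lorentz x f \<le> 0"
      "x \<notin> P"
      unfolding region_iff by (metis region_iff subsetI subset_antisym)
    then have xe: "0 < lorentz x e"
      unfolding PE region_iff by force
    have pe: "lorentz p f < 0" if "f \<in> E" for f
      using that unit half by (intro p(2))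
    (* The positive combination of p and x that is orthogonal to e. *)
    define q where "q = lorentz x e *\<^sub>R p + (- lorentz p e) *\<^sub>R x"
    have q: "q \<in> forward_cone"
      unfolding q_def using x p xe pe[OF e]
      by (intro forward_cone_add forward_cone_scale hyperbolic_subset_forward_cone) auto
    have qe: "lorentz q e = 0"
      by (simp add: q_def lorentz_linear)
    have qf: "lorentz q f < 0" if "f \<in> E - {e}" for f
      using mult_pos_neg[OF xe pe[of f]] mult_nonpos_nonpos[of "lorentz p e" "lorentz x f"]
        that pe[OF e] x(2)[OF that]
      by (simp add: q_def lorentz_linear)
    have in_span: "z \<in> span (facet P e)" and ne: "facet P e \<noteq> {}"
      if "z \<in> forward_cone" "lorentz z e = 0" "\<And>f. f \<in> E - {e} \<Longrightarrow> lorentz z f < 0" for z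
    proof -
      have "normalise z \<in> P"
        unfolding PE
      proof (rule normalise_region[OF that(1)])
        fix f assume "f \<in> E"
        then show "lorentz z f \<le> 0"
          using that(2) that(3)[of f] by (cases "f = e") auto
      qed
      then have "normalise z \<in> facet P e"
        using that by (simp add: facet_def lorentz_normalise_sign)
      then show "z \<in> span (facet P e)" "facet P e \<noteq> {}"
        using normalise_span[OF that(1)] by (blast, blast)
    qed
    (* Both q and q + t u normalise to points of the facet, so their difference lies in its span. *)
    have "u \<in> span (facet P e)" if u: "lorentz u e = 0" for u
    proof -
      obtain t where t: "0 < t" "q + t *\<^sub>R u \<in> forward_cone"
        "\<And>f. f \<in> E - {e} \<Longrightarrow> lorentz (q + t *\<^sub>R u) f < 0"
        using perturb[OF q, of "E - {e}" u] qf fin by blast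
      have "q + t *\<^sub>R u \<in> span (facet P e)"
        using t u qe by (intro in_span) (auto simp: lorentz_linear)
      then have "(1 / t) *\<^sub>R (q + t *\<^sub>R u - q) \<in> span (facet P e)"
        using in_span[OF q qe qf] by (intro span_scale span_diff)
      then show ?thesis using t by simp
    qed
    moreover have "u \<in> {u. lorentz u e = 0}" if "u \<in> span (facet P e)" for u
      using that lorentz_span_zero[of "facet P e" e u] by (auto simp: facet_def)
    ultimately have "span (facet P e) = {u. lorentz u e = 0}" by auto
    moreover have "e \<noteq> 0" using unit[OF e] by auto
    ultimately have "dim (facet P e) = CARD('a)"
      using dim_lorentz_hyperplane[of e] by (metis dim_span)
    then show ?thesis
      using ne[OF q qe qf] unit[OF e] half[OF e] by (simp add: wall_normals_def)
  qed
  then have "wall_normals P = E"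
    using wall_normals_subset[OF P PE fin unit] by auto
  then show "finite (wall_normals P)" "P = region (wall_normals P)"
    using fin PE by auto
qed

text \<open>
  A positive combination of outward normals defines a face of \<open>P\<close> contained in the
  facets of the normals that occur in it with nonzero coefficient, so it defines a wall only if it is one of them.
\<close>

lemma wall_normals_extremal:
  assumes P: "hyp_polyhedron P"
    and N: "e \<in> wall_normals P" "f \<in> wall_normals P" "g \<in> wall_normals P"
    and g: "g = a *\<^sub>R e + b *\<^sub>R f" "0 \<le> a" "0 \<le> b"
  shows "g = e \<or> g = f"
proof -
  (* Both terms are nonpositive on P, and on the facet of g they sum to zero. *)
  have zero: "a * lorentz x e = 0 \<and> b * lorentz x f = 0" if "x \<in> facet P g" for x
  proof -
    have "x \<in> P" "lorentz x g = 0" using that by (simp_all add: facet_def)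
    then have "a * lorentz x e \<le> 0" "b * lorentz x f \<le> 0"
      using g wall_normals_nonpos[OF N(1)] wall_normals_nonpos[OF N(2)]
      by (simp_all add: mult_nonneg_nonpos)
    moreover have "a * lorentz x e + b * lorentz x f = 0"
      using \<open>lorentz x g = 0\<close> by (simp add: g(1) lorentz_linear)
    ultimately show ?thesis by linarith
  qed
  have "a \<noteq> 0 \<or> b \<noteq> 0"
    using g wall_normals_unit[OF N(3)] by auto
  then show ?thesis
  proof
    assume "a \<noteq> 0"
    then show ?thesis
      using zero facet_determines_normal[OF P N(3) wall_normals_unit[OF N(1)] wall_normals_halfspace[OF N(1)]] by simp
  next
    assume "b \<noteq> 0"
    then show ?thesis
      using zero facet_determines_normal[OF P N(3) wall_normals_unit[OF N(2)] wall_normals_halfspace[OF N(2)]] by simp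
  qed
qed

text \<open>
  If \<open>c\<close> is negative, \<open>g\<close> is a positive combination of \<open>e\<close> and \<open>f\<close>; otherwise
  all three coefficients are nonnegative, which an interior point forbids unless they vanish.
\<close>

lemma wall_normals_no_relation:
  assumes P: "hyp_polyhedron P"
    and N: "e \<in> wall_normals P" "f \<in> wall_normals P" "g \<in> wall_normals P"
    and distinct: "g \<noteq> e" "g \<noteq> f"
    and rel: "a *\<^sub>R e + b *\<^sub>R f + c *\<^sub>R g = 0" and nonneg: "0 \<le> a" "0 \<le> b"
  shows "a = 0 \<and> b = 0 \<and> c = 0"
proof (cases "c < 0")
  case True
  have "g = (1 / - c) *\<^sub>R ((- c) *\<^sub>R g)"
    using True by simp
  also have "(- c) *\<^sub>R g = a *\<^sub>R e + b *\<^sub>R f"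
    using rel by (simp add: add_eq_0_iff)
  finally have "g = (a / - c) *\<^sub>R e + (b / - c) *\<^sub>R f"
    by (simp add: scaleR_add_right)
  then have "g = e \<or> g = f"
    by (rule wall_normals_extremal[OF P N]) (use True nonneg in \<open>simp_all add: divide_nonneg_neg divide_nonneg_pos\<close>)
  then show ?thesis using distinct by simp
next
  case False
  obtain p where "p \<in> hyperbolic_space"
    and p: "\<And>e. lorentz e e = 1 \<Longrightarrow> P \<subseteq> halfspace e \<Longrightarrow> lorentz p e < 0"
    by (rule interior_point[OF P]) (rule that)
  have neg: "lorentz p e < 0" "lorentz p f < 0" "lorentz p g < 0"
    using N[THEN wall_normals_unit] N[THEN wall_normals_halfspace] by (simp_all only: p)
  have "lorentz p (a *\<^sub>R e + b *\<^sub>R f + c *\<^sub>R g) = 0"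
    by (simp add: rel)
  then have "a * lorentz p e + b * lorentz p f + c * lorentz p g = 0"
    by (simp add: lorentz_linear)
  moreover have "a * lorentz p e \<le> 0" "b * lorentz p f \<le> 0" "c * lorentz p g \<le> 0"
    using neg nonneg False by (simp_all add: mult_nonneg_nonpos)
  ultimately have "a * lorentz p e = 0" "b * lorentz p f = 0" "c * lorentz p g = 0"
    by linarith+
  then show ?thesis using neg by auto
qed

text \<open>
  Of the three coefficients of a linear relation, two are nonnegative or two are nonpositive. After a change of sign
  and a permutation, \<open>wall_normals_no_relation\<close> applies.
\<close>

lemma wall_normals_independent:
  assumes P: "hyp_polyhedron P"
    and N: "e \<in> wall_normals P" "f \<in> wall_normals P" "g \<in> wall_normals P"
    and distinct: "e \<noteq> f" "e \<noteq> g" "f \<noteq> g"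
  shows "independent {e, f, g}"
proof
  assume "dependent {e, f, g}"
  then obtain u where u: "\<exists>v\<in>{e, f, g}. u v \<noteq> 0" "(\<Sum>v\<in>{e, f, g}. u v *\<^sub>R v) = 0"
    using dependent_finite[of "{e, f, g}"] by auto
  have rel: "u e *\<^sub>R e + u f *\<^sub>R f + u g *\<^sub>R g = 0"
    using u(2) distinct by (simp add: add.assoc)
  (* The scalar s is the change of sign; it will be 1 or -1. *)
  have no_rel: "u e = 0 \<and> u f = 0 \<and> u g = 0"
    if "s *\<^sub>R (u e *\<^sub>R e + u f *\<^sub>R f + u g *\<^sub>R g) = 0" "s \<noteq> 0"
      "(0 \<le> s * u e \<and> 0 \<le> s * u f) \<or> (0 \<le> s * u e \<and> 0 \<le> s * u g) \<or> (0 \<le> s * u f \<and> 0 \<le> s * u g)"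
    for s
  proof -
    note rule = wall_normals_no_relation[OF P]
    from that(1) have r1: "(s * u e) *\<^sub>R e + (s * u f) *\<^sub>R f + (s * u g) *\<^sub>R g = 0"
      by (simp add: scaleR_add_right)
    then have r2: "(s * u e) *\<^sub>R e + (s * u g) *\<^sub>R g + (s * u f) *\<^sub>R f = 0"
      and r3: "(s * u f) *\<^sub>R f + (s * u g) *\<^sub>R g + (s * u e) *\<^sub>R e = 0"
      by (simp_all add: ac_simps)
    note d = distinct distinct[symmetric]
    have "s * u e = 0 \<and> s * u f = 0 \<and> s * u g = 0"
      using that(3)
    proof (elim disjE conjE)
      assume "0 \<le> s * u e" "0 \<le> s * u f"
      then show ?thesis using rule[OF N(1,2,3) d(5,6) r1] by simp
    next
      assume "0 \<le> s * u e" "0 \<le> s * u g"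
      then show ?thesis using rule[OF N(1,3,2) d(4) d(3) r2] by simp
    next
      assume "0 \<le> s * u f" "0 \<le> s * u g"
      then show ?thesis using rule[OF N(2,3,1) d(1,2) r3] by simp
    qed
    then show ?thesis using that(2) by simp
  qed
  have "u e = 0 \<and> u f = 0 \<and> u g = 0"
  proof (cases "(0 \<le> u e \<and> 0 \<le> u f) \<or> (0 \<le> u e \<and> 0 \<le> u g) \<or> (0 \<le> u f \<and> 0 \<le> u g)")
    case True
    then show ?thesis using rel by (intro no_rel[of 1]) simp_all
  next
    case False
    then have "(0 \<le> - u e \<and> 0 \<le> - u f) \<or> (0 \<le> - u e \<and> 0 \<le> - u g) \<or> (0 \<le> - u f \<and> 0 \<le> - u g)"
      by linarith
    then show ?thesis using rel by (intro no_rel[of "-1"]) simp_all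
  qed
  then show False using u(1) by simp
qed

text \<open>
  The three normals are independent, so what is common to their hyperplanes has codimension three: at
  most two walls come together at a face of codimension two.
\<close>

lemma three_walls_dim:
  fixes P :: "'n::finite lorentz_space set"
  assumes P: "hyp_polyhedron P"
    and N: "e \<in> wall_normals P" "f \<in> wall_normals P" "g \<in> wall_normals P"
    and distinct: "e \<noteq> f" "e \<noteq> g" "f \<noteq> g"
    and S: "\<And>x. x \<in> S \<Longrightarrow> lorentz x e = 0 \<and> lorentz x f = 0 \<and> lorentz x g = 0"
  shows "Suc (dim S) < CARD('n)"
proof -
  have "card {e, f, g} = 3" using distinct by simp
  with S wall_normals_independent[OF P N distinct] have "dim S + 2 \<le> CARD('n)"
    by (rule dim_orthogonal_independent_triple)
  then show ?thesis by simp
qed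

section \<open>Coxeter conditions in terms of normals\<close>

lemma wall_angle_facet:
  "hyp_polyhedron P \<Longrightarrow> e \<in> wall_normals P \<Longrightarrow> f \<in> wall_normals P \<Longrightarrow>
    wall_angle P (facet P e) (facet P f) = pi - arccos (lorentz e f)"
  by (simp add: wall_angle_def outward_normal_facet)

text \<open>
  Rewriting the conditions in terms of normals removes the definite description in \<open>outward_normal\<close> from
  the geometric part of the argument.
\<close>

lemma coxeter_polyhedron_iff:
  fixes P :: "'n::finite lorentz_space set"
  shows "coxeter_polyhedron P \<longleftrightarrow> hyp_polyhedron P \<and>
    (\<forall>e\<in>wall_normals P. \<forall>f\<in>wall_normals P. e \<noteq> f \<longrightarrow> facet P e \<inter> facet P f \<noteq> {} \<longrightarrow>
      Suc (dim (facet P e \<inter> facet P f)) = CARD('n) \<longrightarrow>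
      (\<exists>m::nat. 2 \<le> m \<and> pi - arccos (lorentz e f) = pi / real m))"
proof (cases "hyp_polyhedron P")
  case True
  show ?thesis
    unfolding coxeter_polyhedron_def adjacent_walls_def wall_iff
  proof (intro iffI conjI True ballI impI allI; (elim conjE bexE)?)
    fix e f
    assume all: "\<forall>F G. (\<exists>e\<in>wall_normals P. F = facet P e) \<and> (\<exists>e\<in>wall_normals P. G = facet P e) \<and>
        F \<noteq> G \<and> F \<inter> G \<noteq> {} \<and> Suc (dim (F \<inter> G)) = CARD('n) \<longrightarrow>
        (\<exists>m::nat\<ge>2. wall_angle P F G = pi / real m)"
      and N: "e \<in> wall_normals P" "f \<in> wall_normals P" and "e \<noteq> f"
      and meet: "facet P e \<inter> facet P f \<noteq> {}" "Suc (dim (facet P e \<inter> facet P f)) = CARD('n)"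
    then have "facet P e \<noteq> facet P f"
      by (simp add: facet_eq_iff[OF True])
    then have "\<exists>m::nat\<ge>2. wall_angle P (facet P e) (facet P f) = pi / real m"
      using N meet by (intro all[rule_format] conjI bexI[of _ e] bexI[of _ f]) auto
    then show "\<exists>m::nat. 2 \<le> m \<and> pi - arccos (lorentz e f) = pi / real m"
      by (simp add: wall_angle_facet[OF True N])
  next
    fix F G e f
    assume all: "\<forall>e\<in>wall_normals P. \<forall>f\<in>wall_normals P. e \<noteq> f \<longrightarrow> facet P e \<inter> facet P f \<noteq> {} \<longrightarrow>
        Suc (dim (facet P e \<inter> facet P f)) = CARD('n) \<longrightarrow>
        (\<exists>m::nat. 2 \<le> m \<and> pi - arccos (lorentz e f) = pi / real m)"
      and N: "e \<in> wall_normals P" "f \<in> wall_normals P"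
      and FG: "F = facet P e" "G = facet P f" "F \<noteq> G" "F \<inter> G \<noteq> {}" "Suc (dim (F \<inter> G)) = CARD('n)"
    then show "\<exists>m::nat\<ge>2. wall_angle P F G = pi / real m"
      using all[rule_format, OF N] unfolding FG wall_angle_facet[OF True N] by blast
  qed
qed (simp add: coxeter_polyhedron_def)

lemma doubling_wall_iff:
  assumes P: "hyp_polyhedron P"
  shows "doubling_wall P F \<longleftrightarrow> (\<exists>e\<in>wall_normals P. F = facet P e \<and>
    (\<forall>f\<in>wall_normals P. f \<noteq> e \<longrightarrow> facet P e \<inter> facet P f \<noteq> {} \<longrightarrow>
      (\<exists>m::nat. 0 < m \<and> even m \<and> pi - arccos (lorentz e f) = pi / real m)))"
proof -
  have "(\<forall>G. wall P G \<and> G \<noteq> facet P e \<and> meets (facet P e) G \<longrightarrow>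
        (\<exists>m::nat. 0 < m \<and> even m \<and> wall_angle P (facet P e) G = pi / real m)) \<longleftrightarrow>
      (\<forall>f\<in>wall_normals P. f \<noteq> e \<longrightarrow> facet P e \<inter> facet P f \<noteq> {} \<longrightarrow>
        (\<exists>m::nat. 0 < m \<and> even m \<and> pi - arccos (lorentz e f) = pi / real m))" (is "?L \<longleftrightarrow> ?R")
    if e: "e \<in> wall_normals P" for e
  proof
    assume all: ?L
    show ?R
    proof (intro ballI impI)
      fix f assume f: "f \<in> wall_normals P" "f \<noteq> e" "facet P e \<inter> facet P f \<noteq> {}"
      have "wall P (facet P f)"
        unfolding wall_iff by (intro bexI[of _ f] refl f(1))
      moreover have "facet P f \<noteq> facet P e"
        using f(2) by (simp add: facet_eq_iff[OF P f(1) e])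
      ultimately have "\<exists>m::nat. 0 < m \<and> even m \<and> wall_angle P (facet P e) (facet P f) = pi / real m"
        using f(3) all[THEN spec, of "facet P f"] by (simp only: meets_def simp_thms)
      then show "\<exists>m::nat. 0 < m \<and> even m \<and> pi - arccos (lorentz e f) = pi / real m"
        unfolding wall_angle_facet[OF P e f(1)] .
    qed
  next
    assume all: ?R
    show ?L
    proof (intro allI impI)
      fix G assume G: "wall P G \<and> G \<noteq> facet P e \<and> meets (facet P e) G"
      then obtain f where f: "f \<in> wall_normals P" "G = facet P f"
        unfolding wall_iff by (elim conjE bexE)
      have "f \<noteq> e" "facet P e \<inter> facet P f \<noteq> {}"
        using G by (auto simp: meets_def f(2))
      then have "\<exists>m::nat. 0 < m \<and> even m \<and> pi - arccos (lorentz e f) = pi / real m"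
        by (rule all[THEN bspec, OF f(1), THEN mp, THEN mp])
      then show "\<exists>m::nat. 0 < m \<and> even m \<and> wall_angle P (facet P e) G = pi / real m"
        unfolding f(2) wall_angle_facet[OF P e f(1)] .
    qed
  qed
  note normal_form = this
  show ?thesis
  proof
    assume F: "doubling_wall P F"
    then have "wall P F" by (simp only: doubling_wall_def)
    then obtain e where e: "e \<in> wall_normals P" "F = facet P e"
      unfolding wall_iff by (elim bexE)
    show "\<exists>e\<in>wall_normals P. F = facet P e \<and> (\<forall>f\<in>wall_normals P. f \<noteq> e \<longrightarrow>
        facet P e \<inter> facet P f \<noteq> {} \<longrightarrow>
        (\<exists>m::nat. 0 < m \<and> even m \<and> pi - arccos (lorentz e f) = pi / real m))"
      using F unfolding doubling_wall_def e(2) normal_form[OF e(1)]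
      by (intro bexI[of _ e] conjI refl e(1)) (elim conjE)
  next
    assume "\<exists>e\<in>wall_normals P. F = facet P e \<and> (\<forall>f\<in>wall_normals P. f \<noteq> e \<longrightarrow>
        facet P e \<inter> facet P f \<noteq> {} \<longrightarrow>
        (\<exists>m::nat. 0 < m \<and> even m \<and> pi - arccos (lorentz e f) = pi / real m))"
    then obtain e where e: "e \<in> wall_normals P" "F = facet P e" and
      even: "\<forall>f\<in>wall_normals P. f \<noteq> e \<longrightarrow> facet P e \<inter> facet P f \<noteq> {} \<longrightarrow>
        (\<exists>m::nat. 0 < m \<and> even m \<and> pi - arccos (lorentz e f) = pi / real m)"
      by (elim bexE conjE)
    have "wall P (facet P e)"
      unfolding wall_iff by (intro bexI[of _ e] refl e(1))
    with even show "doubling_wall P F"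
      unfolding doubling_wall_def e(2) normal_form[OF e(1)] by (intro conjI)
  qed
qed

lemma facets_meet_bound:
  assumes "hyp_polyhedron P" "e \<in> wall_normals P" "f \<in> wall_normals P"
    and "facet P e \<inter> facet P f \<noteq> {}"
  shows "\<bar>lorentz e f\<bar> \<le> 1"
proof -
  obtain x where "x \<in> facet P e \<inter> facet P f"
    using assms(4) by blast
  then have x: "x \<in> P" "lorentz x e = 0" "lorentz x f = 0"
    by (simp_all add: facet_def)
  have "P \<subseteq> hyperbolic_space"
    using region_wall_normals(2)[OF assms(1)] by (auto simp: region_def)
  then have "x \<in> hyperbolic_space" using x(1) by (rule subsetD)
  then show ?thesis
    using x assms by (intro tangent_unit_bound[of x] hyperbolic_subset_forward_cone)
      (simp_all add: wall_normals_unit)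
qed

section \<open>Nonobtuse angles along a doubling wall\<close>

text \<open>
  In contrast to \<open>doubling_wall P w\<close>, the letter \<open>w\<close> stands here for the outward normal of the wall across
  which \<open>P\<close> is doubled, not for the wall itself.
\<close>

locale doubled_polyhedron =
  fixes P :: "'n::finite lorentz_space set" and w :: "'n lorentz_space"
  assumes polyhedron: "hyp_polyhedron P"
    and w: "w \<in> wall_normals P"
    and even_angle: "\<And>f. f \<in> wall_normals P \<Longrightarrow> f \<noteq> w \<Longrightarrow> facet P w \<inter> facet P f \<noteq> {} \<Longrightarrow>
      \<exists>m::nat. 0 < m \<and> even m \<and> pi - arccos (lorentz w f) = pi / real m"
begin

abbreviation "N \<equiv> wall_normals P"
abbreviation "r \<equiv> reflection w"
abbreviation "D \<equiv> P \<union> r ` P"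

lemma w_unit: "lorentz w w = 1"
  using w by (rule wall_normals_unit)

lemma in_P_iff: "x \<in> P \<longleftrightarrow> x \<in> hyperbolic_space \<and> (\<forall>e\<in>N. lorentz x e \<le> 0)"
proof -
  have "x \<in> P \<longleftrightarrow> x \<in> region N"
    by (rule arg_cong[OF region_wall_normals(2)[OF polyhedron]])
  then show ?thesis by (simp only: region_iff)
qed

lemma P_hyperbolic: "x \<in> P \<Longrightarrow> x \<in> hyperbolic_space"
  by (simp add: in_P_iff)

lemma normalise_P:
  "x \<in> forward_cone \<Longrightarrow> (\<And>e. e \<in> N \<Longrightarrow> lorentz x e \<le> 0) \<Longrightarrow> normalise x \<in> P"
  by (simp add: in_P_iff normalise_in_hyperbolic lorentz_normalise_sign)

lemma meeting_angle:
  assumes f: "f \<in> N" "f \<noteq> w" and meet: "facet P w \<inter> facet P f \<noteq> {}"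
  obtains m :: nat where "0 < m" "even m" "lorentz w f = - cos (pi / real m)"
proof -
  obtain m :: nat where m: "0 < m" "even m" "pi - arccos (lorentz w f) = pi / real m"
    using even_angle[OF f meet] by blast
  have "\<bar>lorentz w f\<bar> \<le> 1"
    using polyhedron w f(1) meet by (rule facets_meet_bound)
  then have "lorentz w f = cos (arccos (lorentz w f))"
    by (simp add: abs_le_iff)
  also have "arccos (lorentz w f) = pi - pi / real m"
    using m(3) by simp
  finally show ?thesis
    using m by (intro that) simp_all
qed

lemma meeting_nonpos:
  assumes f: "f \<in> N" "f \<noteq> w" and meet: "facet P w \<inter> facet P f \<noteq> {}"
  shows "lorentz w f \<le> 0"
proof -
  obtain m :: nat where m: "0 < m" "even m" "lorentz w f = - cos (pi / real m)"
    using meeting_angle[OF f meet] .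
  then have "2 \<le> m" by (auto elim: evenE)
  then have "pi / real m \<le> pi / 2"
    by (intro divide_left_mono) auto
  moreover have "- (pi / 2) \<le> 0" "0 \<le> pi / real m" by simp_all
  ultimately have "0 \<le> cos (pi / real m)"
    by (intro cos_ge_zero) linarith+
  then show ?thesis using m(3) by simp
qed

lemma lorentz_r: "lorentz (r y) f = lorentz y f - 2 * (lorentz y w * lorentz w f)"
  by (simp add: reflection_def lorentz_linear)

text \<open>
  Suppose \<open>lorentz w f\<close> were nonnegative and project a point \<open>y\<close> of the facet of \<open>f\<close>
  orthogonally to the hyperplane of \<open>w\<close>; up to scaling the projection is \<open>z = y + r y\<close>. It satisfies the
  inequalities of all walls meeting that of \<open>w\<close>, because their angles with it are nonobtuse, while
  \<open>lorentz z f\<close> is nonnegative. If \<open>z\<close> normalises to a point of \<open>P\<close>, that point lies on both facets. If not, walk from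
  a point \<open>q\<close> of the facet of \<open>w\<close> towards \<open>z\<close> inside the hyperplane of \<open>w\<close>: the wall through which this
  segment first leaves \<open>P\<close> meets that of \<open>w\<close>, and so is not violated at \<open>z\<close> after all.
\<close>

lemma disjoint_neg:
  assumes f: "f \<in> N" and disj: "facet P w \<inter> facet P f = {}"
  shows "lorentz w f < 0"
proof (rule ccontr)
  assume "\<not> lorentz w f < 0"
  have "facet P f \<noteq> {}" "facet P w \<noteq> {}"
    using f w by (simp_all add: wall_normals_def)
  then obtain y q where "y \<in> facet P f" "q \<in> facet P w" by blast
  then have y: "y \<in> P" "lorentz y f = 0" and q: "q \<in> P" "lorentz q w = 0"
    by (simp_all add: facet_def)
  have yw: "lorentz y w \<le> 0"
    using wall_normals_nonpos[OF w y(1)] .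
  define z where "z = y + r y"
  have z: "z \<in> forward_cone"
    unfolding z_def using P_hyperbolic[OF y(1)]
    by (intro forward_cone_add hyperbolic_subset_forward_cone reflection_hyperbolic w_unit)
  have zw: "lorentz z w = 0"
    by (simp add: z_def lorentz_linear lorentz_reflection_normal[OF w_unit])
  have zg: "lorentz z g = 2 * lorentz y g - 2 * (lorentz y w * lorentz w g)" for g
    by (simp add: z_def lorentz_linear lorentz_r)
  have zf: "0 \<le> lorentz z f"
    using mult_nonpos_nonneg[OF yw, of "lorentz w f"] \<open>\<not> lorentz w f < 0\<close>
    unfolding zg y(2) by linarith
  show False
  proof (cases "\<forall>g\<in>N. lorentz z g \<le> 0")
    case True
    have "normalise z \<in> P"
      by (rule normalise_P[OF z True[THEN bspec]])
    moreover have "lorentz z f = 0"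
      using True[THEN bspec, OF f] zf by (rule order_antisym)
    ultimately have "normalise z \<in> facet P w \<inter> facet P f"
      using zw by (simp add: facet_def lorentz_normalise_sign[OF z])
    then show False using disj by simp
  next
    case False
    (* The wall of g is crossed at q + s g * z, so the first exit is through a g minimising s. *)
    define V where "V = {g \<in> N. 0 < lorentz z g}"
    define s where "s g = - lorentz q g / lorentz z g" for g
    have "finite V"
      using region_wall_normals(1)[OF polyhedron] by (simp add: V_def)
    moreover have "V \<noteq> {}"
      using False unfolding V_def not_le[symmetric] by fast
    ultimately have fin: "finite (s ` V)" and "s ` V \<noteq> {}" by simp_all
    then have "Min (s ` V) \<in> s ` V" by (rule Min_in)
    then obtain g where g: "s g = Min (s ` V)" "g \<in> V"
      by (elim imageE) (rule that[OF sym])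
    have min: "s g \<le> s h" if "h \<in> V" for h
      unfolding g(1) using fin imageI[OF that] by (rule Min_le)
    have gN: "g \<in> N" and gpos: "0 < lorentz z g"
      using g(2) by (simp_all add: V_def)
    have qN: "lorentz q h \<le> 0" if "h \<in> N" for h
      using that q(1) by (rule wall_normals_nonpos)
    have s: "0 \<le> s g"
      using qN[OF gN] gpos by (simp add: s_def divide_nonpos_pos)
    define x where "x = q + s g *\<^sub>R z"
    have x: "x \<in> forward_cone"
      unfolding x_def
      by (rule forward_cone_add_scale[OF hyperbolic_subset_forward_cone[OF P_hyperbolic[OF q(1)]] z s])
    have "lorentz x h \<le> 0" if h: "h \<in> N" for h
    proof (cases "h \<in> V")
      case True
      then have zh: "0 < lorentz z h" by (simp add: V_def)
      then have "s g * lorentz z h \<le> s h * lorentz z h"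
        by (intro mult_right_mono min True less_imp_le)
      moreover have "s h * lorentz z h = - lorentz q h"
        using zh by (simp add: s_def)
      ultimately show ?thesis by (simp add: x_def lorentz_linear)
    next
      case False
      then have "s g * lorentz z h \<le> 0"
        using h s by (simp add: V_def mult_nonneg_nonpos)
      then show ?thesis
        using qN[OF h] by (simp add: x_def lorentz_linear)
    qed
    with x have "normalise x \<in> P"
      by (rule normalise_P)
    moreover have "lorentz x g = 0" "lorentz x w = 0"
      using gpos q(2) zw by (simp_all add: x_def lorentz_linear s_def)
    ultimately have "normalise x \<in> facet P w \<inter> facet P g"
      by (simp add: facet_def lorentz_normalise_sign[OF x])
    then have meet: "facet P w \<inter> facet P g \<noteq> {}" by blast
    have "g \<noteq> w"
    proof
      assume "g = w"
      then show False using gpos zw by simp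
    qed
    then have "0 \<le> lorentz y w * lorentz w g"
      using meeting_nonpos[OF gN _ meet] yw by (simp add: mult_nonpos_nonpos)
    moreover have "lorentz y g \<le> 0"
      using gN y(1) by (rule wall_normals_nonpos)
    ultimately show False
      using gpos by (simp add: zg)
  qed
qed

lemma nonobtuse:
  assumes "f \<in> N" "f \<noteq> w"
  shows "lorentz w f \<le> 0"
proof (cases "facet P w \<inter> facet P f = {}")
  case True
  then show ?thesis using disjoint_neg[OF assms(1)] by simp
next
  case False
  then show ?thesis using meeting_nonpos[OF assms] by simp
qed

lemma product_nonneg:
  assumes "f \<in> N" "f \<noteq> w" "y \<in> P"
  shows "0 \<le> lorentz y w * lorentz w f"
  using nonobtuse[OF assms(1,2)] wall_normals_nonpos[OF w assms(3)] by (rule mult_nonpos_nonpos[rotated])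

section \<open>Convexity of the double\<close>

lemma in_D_iff: "x \<in> D \<longleftrightarrow> x \<in> P \<or> r x \<in> P"
proof -
  have "x \<in> r ` P \<longleftrightarrow> r x \<in> P"
  proof
    assume "x \<in> r ` P"
    then show "r x \<in> P" by (elim imageE) (simp add: reflection_involution[OF w_unit])
  next
    assume "r x \<in> P"
    then have "r (r x) \<in> r ` P" by (rule imageI)
    then show "x \<in> r ` P" by (simp add: reflection_involution[OF w_unit])
  qed
  then show ?thesis by simp
qed

lemma reflect_in_D: "r x \<in> D \<longleftrightarrow> x \<in> D"
  by (auto simp only: in_D_iff reflection_involution[OF w_unit])

lemma D_halfspace:
  assumes "x \<in> D" "lorentz x w \<le> 0"
  shows "x \<in> P"
proof (cases "x \<in> P")
  case False
  then have "r x \<in> P" using assms(1) by (simp only: in_D_iff simp_thms)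
  then have "lorentz (r x) w \<le> 0" by (rule wall_normals_nonpos[OF w])
  then have "lorentz x w = 0"
    using assms(2) by (simp add: lorentz_reflection_normal[OF w_unit])
  then have "r x = x" by (rule reflection_fixed)
  then show ?thesis
    using \<open>r x \<in> P\<close> by (simp only:)
qed

text \<open>
  At a reflected point \<open>r y\<close> the value of \<open>f\<close> changes by
  \<open>- 2 * (lorentz y w * lorentz w f)\<close>, which is nonpositive because both factors are.
\<close>

lemma D_nonpos:
  assumes x: "x \<in> D" and f: "f \<in> N" "f \<noteq> w"
  shows "lorentz x f \<le> 0"
proof (cases "x \<in> P")
  case True
  then show ?thesis by (rule wall_normals_nonpos[OF f(1)])
next
  case False
  then have rx: "r x \<in> P" using x by (simp only: in_D_iff simp_thms)
  have "lorentz x f = lorentz (r x) f - 2 * (lorentz (r x) w * lorentz w f)"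
    by (simp add: lorentz_r[symmetric] reflection_involution[OF w_unit])
  then show ?thesis
    using product_nonneg[OF f rx] wall_normals_nonpos[OF f(1) rx] by simp
qed

definition double_normals :: "'n lorentz_space set" where
  "double_normals = (N - {w}) \<union> r ` (N - {w})"

text \<open>
  The double is convex. A point of the region on the inner side of the mirror satisfies the inequalities
  of \<open>P\<close>; for a point on the outer side the inequalities of the mirrored normals \<open>r f\<close> say the same about its mirror image.
\<close>

lemma D_region: "D = region double_normals"
proof (intro set_eqI iffI)
  fix x assume x: "x \<in> D"
  have "x \<in> hyperbolic_space"
    using x P_hyperbolic reflection_hyperbolic[OF w_unit] by (elim UnE imageE) simp_all
  moreover have "lorentz x e \<le> 0" if "e \<in> double_normals" for e
    using that unfolding double_normals_def
  proof (elim UnE imageE)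
    fix f assume "e = r f" "f \<in> N - {w}"
    then show ?thesis
      using D_nonpos[of "r x" f] x by (simp add: reflect_in_D lorentz_reflection_left[OF w_unit] del: Un_iff)
  qed (use D_nonpos[OF x] in simp)
  ultimately show "x \<in> region double_normals" by (simp add: region_iff)
next
  fix x assume "x \<in> region double_normals"
  then have x: "x \<in> hyperbolic_space" and xe: "\<And>e. e \<in> double_normals \<Longrightarrow> lorentz x e \<le> 0"
    by (simp_all add: region_iff)
  show "x \<in> D"
  proof (cases "lorentz x w \<le> 0")
    case True
    have "lorentz x e \<le> 0" if "e \<in> N" for e
      using True that by (cases "e = w") (simp_all add: xe double_normals_def)
    then have "x \<in> P" using x by (simp add: in_P_iff)
    then show ?thesis by simp
  next
    case False
    have "lorentz (r x) e \<le> 0" if "e \<in> N" for e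
    proof (cases "e = w")
      case True
      then show ?thesis using False by (simp add: lorentz_reflection_normal[OF w_unit])
    next
      case ne: False
      then have "r e \<in> double_normals" using that by (simp add: double_normals_def)
      then show ?thesis using xe by (simp add: lorentz_reflection_left[OF w_unit])
    qed
    then have "r x \<in> P" using x by (simp add: in_P_iff reflection_hyperbolic[OF w_unit])
    then show ?thesis by (simp only: in_D_iff simp_thms)
  qed
qed

lemma double_normals_unit:
  assumes "e \<in> double_normals"
  shows "lorentz e e = 1"
  using assms unfolding double_normals_def
proof (elim UnE imageE)
  assume "e \<in> N - {w}"
  then have "e \<in> N" by simp
  then show ?thesis by (rule wall_normals_unit)
next
  fix f assume f: "e = r f" "f \<in> N - {w}"
  then have "f \<in> N" by simp
  then show ?thesis
    unfolding f(1) lorentz_reflection[OF w_unit] by (rule wall_normals_unit)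
qed

lemma finite_double_normals: "finite double_normals"
  using region_wall_normals(1)[OF polyhedron] by (simp add: double_normals_def)

lemma hyp_polyhedron_D: "hyp_polyhedron D"
proof -
  have "top_of_set hyperbolic_space interior_of P \<subseteq> top_of_set hyperbolic_space interior_of D"
    by (rule interior_of_mono) simp
  then have "top_of_set hyperbolic_space interior_of D \<noteq> {}"
    using polyhedron by (auto simp: hyp_polyhedron_def)
  moreover have "D = hyperbolic_space \<inter> (\<Inter>e\<in>double_normals. halfspace e)"
    using D_region by (simp add: region_def)
  ultimately show ?thesis
    unfolding hyp_polyhedron_def using finite_double_normals double_normals_unit by blast
qed

lemma wall_normals_D: "wall_normals D \<subseteq> double_normals"
  using hyp_polyhedron_D D_region finite_double_normals double_normals_unit by (rule wall_normals_subset)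

section \<open>Dihedral angles of the double\<close>

text \<open>
  Both terms of \<open>lorentz (r y) f = lorentz y f - 2 * (lorentz y w * lorentz w f)\<close> are nonpositive, so they vanish
  together.
\<close>

lemma reflected_zero:
  assumes y: "y \<in> P" and f: "f \<in> N" "f \<noteq> w" and zero: "lorentz (r y) f = 0"
  shows "lorentz y f = 0 \<and> (lorentz y w = 0 \<or> lorentz w f = 0)"
proof -
  have "lorentz y f \<le> 0" "0 \<le> lorentz y w * lorentz w f"
    "lorentz y f - 2 * (lorentz y w * lorentz w f) = 0"
    using wall_normals_nonpos[OF f(1) y] product_nonneg[OF f y] zero by (simp_all only: lorentz_r)
  then have "lorentz y f = 0" "lorentz y w * lorentz w f = 0" by linarith+
  then show ?thesis by simp
qed

lemma reflected_hyperplane: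
  assumes "lorentz w f = 0"
  shows "r f = f"
  using assms by (intro reflection_fixed) (simp add: lorentz_commute)

lemma facet_reflect: "x \<in> facet D (r e) \<longleftrightarrow> r x \<in> facet D e"
  unfolding facet_def mem_Collect_eq reflect_in_D lorentz_reflection_left[OF w_unit] ..

lemma facet_reflect_image: "facet D (r e) = r ` facet D e"
proof (intro set_eqI iffI)
  fix x assume "x \<in> facet D (r e)"
  then have "r x \<in> facet D e" by (simp only: facet_reflect)
  then have "r (r x) \<in> r ` facet D e" by (rule imageI)
  then show "x \<in> r ` facet D e" by (simp only: reflection_involution[OF w_unit])
next
  fix x assume "x \<in> r ` facet D e"
  then show "x \<in> facet D (r e)"
    by (elim imageE) (simp only: facet_reflect reflection_involution[OF w_unit])
qed

lemma dim_r_image: "dim (r ` S) = dim S"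
  by (rule dim_image_eq[OF linear_reflection]) (rule inj_on_subset[OF inj_reflection[OF w_unit] subset_UNIV])

text \<open>
  Unless it is perpendicular to the mirror, the hyperplane of \<open>f\<close> meets the reflected copy of \<open>P\<close> only on the
  mirror itself.
\<close>

lemma in_facet_D:
  assumes f: "f \<in> N" "f \<noteq> w" and x: "x \<in> facet D f"
  shows "x \<in> facet P f \<or> (lorentz w f = 0 \<and> r x \<in> facet P f)"
proof (cases "x \<in> P")
  case True
  then show ?thesis using x by (simp add: facet_def)
next
  case False
  have xD: "x \<in> D" and xf: "lorentz x f = 0" using x by (simp_all only: facet_def mem_Collect_eq)
  then have rx: "r x \<in> P" using False by (simp only: in_D_iff simp_thms)
  have "lorentz (r x) f = 0 \<and> (lorentz (r x) w = 0 \<or> lorentz w f = 0)"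
    using xf by (intro reflected_zero rx f) (simp only: reflection_involution[OF w_unit])
  moreover have "lorentz (r x) w \<noteq> 0"
  proof
    assume "lorentz (r x) w = 0"
    then have "r x = x"
      by (intro reflection_fixed) (simp add: lorentz_reflection_normal[OF w_unit])
    then show False using rx False by (simp only:)
  qed
  ultimately show ?thesis using rx by (simp add: facet_def)
qed

text \<open>
  If one of the two hyperplanes is not perpendicular to the mirror, the ridge of \<open>D\<close> lies inside \<open>P\<close>. If
  both are, the ridge is symmetric about the mirror and crosses it, since by \<open>three_walls_dim\<close> it is too large to be contained in it.
  The half of the ridge in \<open>P\<close> then has points off the mirror, and adding a multiple of such a
  point to any other point of the ridge leads back into \<open>P\<close>; hence that half
  already spans the whole ridge.
\<close>

lemma adjacent_same_side:
  assumes e: "e \<in> N" "e \<noteq> w" and f: "f \<in> N" "f \<noteq> w" and "e \<noteq> f"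
    and ne: "facet D e \<inter> facet D f \<noteq> {}"
    and dim: "Suc (dim (facet D e \<inter> facet D f)) = CARD('n)"
  shows "facet P e \<inter> facet P f \<noteq> {} \<and> Suc (dim (facet P e \<inter> facet P f)) = CARD('n)"
proof -
  let ?S = "facet D e \<inter> facet D f" and ?G = "facet P e \<inter> facet P f"
  have sub: "?G \<subseteq> ?S" by (auto simp: facet_def)
  show ?thesis
  proof (cases "lorentz w e = 0 \<and> lorentz w f = 0")
    case False
    have "?S \<subseteq> ?G"
    proof
      fix x assume "x \<in> ?S"
      then have x: "x \<in> facet D e" "x \<in> facet D f" by simp_all
      have "x \<in> P"
        using in_facet_D[OF e x(1)] in_facet_D[OF f x(2)] False by (auto simp only: facet_def mem_Collect_eq)
      then show "x \<in> ?G" using x by (simp add: facet_def)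
    qed
    then have "?S = ?G" using sub by (rule subset_antisym)
    then show ?thesis using ne dim by (simp only: simp_thms)
  next
    case True
    then have re: "r e = e" and rf: "r f = f" by (simp_all add: reflected_hyperplane)
    have S_refl: "r x \<in> ?S" if "x \<in> ?S" for x
      using that facet_reflect[of x e] facet_reflect[of x f] by (simp only: re rf Int_iff simp_thms)
    have S_half: "x \<in> ?G" if "x \<in> ?S" "lorentz x w \<le> 0" for x
    proof -
      have "x \<in> D" "lorentz x e = 0" "lorentz x f = 0"
        using that(1) by (simp_all only: facet_def mem_Collect_eq Int_iff)
      then show ?thesis
        using D_halfspace[OF _ that(2)] by (simp only: facet_def mem_Collect_eq Int_iff simp_thms)
    qed
    have "\<exists>x\<in>?S. lorentz x w \<noteq> 0"
    proof (rule ccontr)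
      assume no: "\<not> (\<exists>x\<in>?S. lorentz x w \<noteq> 0)"
      have "lorentz x e = 0 \<and> lorentz x f = 0 \<and> lorentz x w = 0" if "x \<in> ?S" for x
        using no that by (simp only: facet_def mem_Collect_eq Int_iff bex_simps simp_thms ball_simps)
      then have "Suc (dim ?S) < CARD('n)"
        by (rule three_walls_dim[OF polyhedron e(1) f(1) w \<open>e \<noteq> f\<close> e(2) f(2)])
      then show False using dim by simp
    qed
    then obtain y where y: "y \<in> ?S" "lorentz y w \<noteq> 0" by (elim bexE)
    obtain x where x: "x \<in> ?S" "lorentz x w < 0"
    proof (cases "lorentz y w < 0")
      case True
      then show ?thesis using y(1) by (intro that)
    next
      case False
      then have "lorentz (r y) w < 0"
        using y(2) by (simp add: lorentz_reflection_normal[OF w_unit])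
      then show ?thesis using S_refl[OF y(1)] by (intro that)
    qed
    have xG: "x \<in> ?G" using S_half[OF x(1)] x(2) by simp
    have "z \<in> span ?G" if z: "z \<in> ?S" for z
    proof (cases "lorentz z w \<le> 0")
      case True
      then show ?thesis using S_half[OF z] by (intro span_base)
    next
      case False
      (* With this t the point z + t x of the ridge lies on the mirror, hence normalises to a point of P. *)
      define t where "t = - lorentz z w / lorentz x w"
      have t: "0 \<le> t"
        using False x(2) by (simp add: t_def divide_nonneg_neg)
      define u where "u = z + t *\<^sub>R x"
      have z0: "z \<in> D" "lorentz z e = 0" "lorentz z f = 0"
        and x0: "x \<in> D" "lorentz x e = 0" "lorentz x f = 0"
        using z x(1) by (simp_all only: facet_def mem_Collect_eq Int_iff)
      have zr: "z \<in> region double_normals" and xr: "x \<in> region double_normals"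
        using z0(1) x0(1) by (simp_all only: D_region)
      have u: "u \<in> forward_cone"
        unfolding u_def using zr xr
        by (intro forward_cone_add_scale t hyperbolic_subset_forward_cone) (simp_all add: region_iff)
      have "lorentz u a \<le> 0" if "a \<in> double_normals" for a
        using zr xr t that by (simp add: u_def lorentz_linear region_iff add_nonpos_nonpos mult_nonneg_nonpos)
      then have "normalise u \<in> D"
        unfolding D_region by (rule normalise_region[OF u])
      moreover have "lorentz u e = 0" "lorentz u f = 0" "lorentz u w = 0"
        using z0 x0 x(2) by (simp_all add: u_def lorentz_linear t_def)
      ultimately have "normalise u \<in> ?S" "lorentz (normalise u) w \<le> 0"
        by (simp_all only: facet_def mem_Collect_eq Int_iff lorentz_normalise_sign[OF u] order_refl simp_thms)
      then have "normalise u \<in> ?G" by (rule S_half)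
      then have "u \<in> span ?G" by (rule normalise_span[OF u])
      then have "u - t *\<^sub>R x \<in> span ?G"
        by (rule span_diff[OF _ span_scale[OF span_base[OF xG]]])
      then show ?thesis by (simp add: u_def)
    qed
    then have "?S \<subseteq> span ?G" by (rule subsetI)
    then have "dim ?S \<le> dim ?G" by (rule dim_mono)
    moreover have "dim ?G \<le> dim ?S" using sub by (rule dim_subset)
    ultimately have "dim ?G = dim ?S" by simp
    moreover have "?G \<noteq> {}" using xG by (rule ex_in_conv[THEN iffD1, OF exI])
    ultimately show ?thesis using dim by (simp only: simp_thms)
  qed
qed

text \<open>
  Each of the two hyperplanes is inclined to the mirror, so the ridge lies in both \<open>P\<close> and its
  mirror image and thus on the mirror. It is then a common face of the walls of \<open>w\<close>, \<open>e\<close> and \<open>f\<close>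
  of \<open>P\<close>, which cannot all be different.
\<close>

lemma adjacent_opposite_sides:
  assumes e: "e \<in> N" "e \<noteq> w" and f: "f \<in> N" "f \<noteq> w"
    and we: "lorentz w e \<noteq> 0" and wf: "lorentz w f \<noteq> 0"
    and ne: "facet D e \<inter> facet D (r f) \<noteq> {}"
    and dim: "Suc (dim (facet D e \<inter> facet D (r f))) = CARD('n)"
  shows "e = f \<and> facet P w \<inter> facet P e \<noteq> {}"
proof -
  let ?S = "facet D e \<inter> facet D (r f)"
  have S: "x \<in> P \<and> lorentz x e = 0 \<and> lorentz x f = 0 \<and> lorentz x w = 0" if "x \<in> ?S" for x
  proof -
    have x: "x \<in> facet D e" "r x \<in> facet D f"
      using that by (simp_all only: Int_iff facet_reflect)
    have 1: "x \<in> facet P e" using in_facet_D[OF e x(1)] we by (simp only: simp_thms)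
    have 2: "r x \<in> facet P f" using in_facet_D[OF f x(2)] wf by (simp only: simp_thms)
    have "lorentz x w \<le> 0" "lorentz (r x) w \<le> 0" "x \<in> P" "lorentz x e = 0" "lorentz (r x) f = 0"
      using 1 2 by (simp_all only: facet_def mem_Collect_eq wall_normals_nonpos[OF w])
    moreover from this have "lorentz x w = 0"
      by (simp add: lorentz_reflection_normal[OF w_unit])
    moreover from this have "r x = x" by (rule reflection_fixed)
    ultimately show ?thesis by (simp only: simp_thms)
  qed
  have "e = f"
  proof (rule ccontr)
    assume "e \<noteq> f"
    moreover have "lorentz x e = 0 \<and> lorentz x f = 0 \<and> lorentz x w = 0" if "x \<in> ?S" for x
      by (rule conjunct2[OF S[OF that]])
    ultimately have "Suc (dim ?S) < CARD('n)"
      by (rule three_walls_dim[OF polyhedron e(1) f(1) w _ e(2) f(2)])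
    then show False using dim by simp
  qed
  moreover have "\<exists>x. x \<in> ?S"
    using ne by (simp only: ex_in_conv simp_thms)
  then obtain x where "x \<in> ?S" by (elim exE)
  then have "x \<in> facet P w \<inter> facet P e"
    using S[of x] by (simp only: facet_def Int_iff mem_Collect_eq simp_thms)
  then have "facet P w \<inter> facet P e \<noteq> {}"
    by (rule ex_in_conv[THEN iffD1, OF exI])
  ultimately show ?thesis by (rule conjI)
qed

text \<open>
  With \<open>lorentz w e = - cos (pi / m)\<close> the double-angle formula gives
  \<open>lorentz e (r e) = - cos (2 * pi / m)\<close>. Writing \<open>m = 2 * k\<close>, the angle is \<open>pi / k\<close>; the value
  \<open>k = 1\<close> is the perpendicular case, in which \<open>r e = e\<close> and there is only one wall.
\<close>

lemma half_angle:
  assumes e: "e \<in> N" "e \<noteq> w" and we: "lorentz w e \<noteq> 0" and meet: "facet P w \<inter> facet P e \<noteq> {}"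
  shows "\<exists>m::nat. 2 \<le> m \<and> pi - arccos (lorentz e (r e)) = pi / real m"
proof -
  obtain m :: nat where m: "0 < m" "even m" "lorentz w e = - cos (pi / real m)"
    using meeting_angle[OF e meet] .
  then obtain k where k: "m = 2 * k" by (elim evenE)
  have "k \<noteq> 0" using m k by simp
  have "k \<noteq> 1" using m(3) we k by auto
  then have "2 \<le> k" using \<open>k \<noteq> 0\<close> by simp
  have "lorentz e (r e) = 1 - 2 * (lorentz w e)\<^sup>2"
    by (simp add: reflection_def lorentz_linear wall_normals_unit[OF e(1)] lorentz_commute[of e w]
      power2_eq_square)
  also have "\<dots> = - cos (2 * (pi / real m))"
    unfolding cos_double_cos m(3) by simp
  also have "2 * (pi / real m) = pi / real k"
    by (simp add: k)
  also have "- cos (pi / real k) = cos (pi - pi / real k)"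
    by simp
  finally have "arccos (lorentz e (r e)) = arccos (cos (pi - pi / real k))"
    by simp
  also have "\<dots> = pi - pi / real k"
    using \<open>2 \<le> k\<close> by (intro arccos_cos) (simp_all add: divide_le_eq_1 field_simps)
  finally show ?thesis
    using \<open>2 \<le> k\<close> by (intro exI[of _ k]) simp
qed

lemma facets_reflect: "facet D (r a) \<inter> facet D (r b) = r ` (facet D a \<inter> facet D b)"
  unfolding facet_reflect_image by (rule image_Int[OF inj_reflection[OF w_unit], symmetric])

lemma double_normals_cases:
  assumes "e \<in> double_normals"
  obtains (original) "e \<in> N" "e \<noteq> w" | (mirrored) f where "f \<in> N" "f \<noteq> w" "e = r f"
  using assms unfolding double_normals_def
proof (elim UnE imageE)
  assume "e \<in> N - {w}"
  then show thesis by (intro original) simp_all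
next
  fix f assume "e = r f" "f \<in> N - {w}"
  then show thesis by (intro mirrored[of f]) simp_all
qed

text \<open>
  The perpendicular walls are exactly those with \<open>r f = f\<close>. A pair \<open>a\<close>, \<open>r b\<close> from
  opposite sides in which one of them is perpendicular is therefore also a pair from the same side, up to reflecting
  both; the remaining mixed pairs are of the form \<open>a\<close>, \<open>r a\<close>.
\<close>

lemma coxeter_D:
  assumes "coxeter_polyhedron P"
  shows "coxeter_polyhedron D"
proof -
  define good where
    "good e f \<longleftrightarrow> (\<exists>m::nat. 2 \<le> m \<and> pi - arccos (lorentz e f) = pi / real m)"
    for e f :: "'n lorentz_space"
  define adj where
    "adj e f \<longleftrightarrow> facet D e \<inter> facet D f \<noteq> {} \<and> Suc (dim (facet D e \<inter> facet D f)) = CARD('n)" for e f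
  have adj_r: "adj (r a) (r b) \<longleftrightarrow> adj a b" for a b
    unfolding adj_def facets_reflect dim_r_image image_is_empty ..
  have adj_sym: "adj a b \<longleftrightarrow> adj b a" for a b
    unfolding adj_def Int_commute[of "facet D a" "facet D b"] ..
  have good_sym: "good a b \<longleftrightarrow> good b a" for a b
    unfolding good_def lorentz_commute[of a b] ..
  have cox: "good e f" if "e \<in> N" "f \<in> N" "e \<noteq> f"
    "facet P e \<inter> facet P f \<noteq> {} \<and> Suc (dim (facet P e \<inter> facet P f)) = CARD('n)" for e f
    using assms[unfolded coxeter_polyhedron_iff, THEN conjunct2, THEN bspec, OF that(1), THEN bspec, OF that(2)]
      that(3,4) unfolding good_def by (elim conjE impE)
  have same: "good a b"
    if "a \<in> N" "a \<noteq> w" "b \<in> N" "b \<noteq> w" "a \<noteq> b" "adj a b" for a b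
    by (rule cox[OF that(1,3,5) adjacent_same_side[OF that(1-5)
      that(6)[unfolded adj_def, THEN conjunct1] that(6)[unfolded adj_def, THEN conjunct2]]])
  have opposite: "good a (r b)"
    if a: "a \<in> N" "a \<noteq> w" and b: "b \<in> N" "b \<noteq> w" and ne: "a \<noteq> r b" and adj: "adj a (r b)" for a b
  proof -
    consider "lorentz w b = 0" | "lorentz w a = 0" | "lorentz w a \<noteq> 0" "lorentz w b \<noteq> 0" by blast
    then show ?thesis
    proof cases
      case 1
      then have "r b = b" by (rule reflected_hyperplane)
      then show ?thesis using same[OF a b] ne adj by (simp only: simp_thms)
    next
      case 2
      then have ra: "r a = a" by (rule reflected_hyperplane)
      have "a \<noteq> b"
      proof
        assume "a = b"
        then show False using ne ra by (simp only: simp_thms)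
      qed
      moreover have "adj a b" using adj_r[of a b] adj by (simp only: ra simp_thms)
      ultimately have "good a b" by (rule same[OF a b])
      moreover have "lorentz a (r b) = lorentz a b"
        by (simp only: lorentz_reflection_left[OF w_unit, symmetric] ra)
      ultimately show ?thesis by (simp only: good_def)
    next
      case 3
      note adj' = adj[unfolded adj_def, THEN conjunct1] adj[unfolded adj_def, THEN conjunct2]
      have ab: "a = b" and meet: "facet P w \<inter> facet P a \<noteq> {}"
        using adjacent_opposite_sides[OF a b 3 adj'] by (rule conjunct1, rule conjunct2)
      show ?thesis
        using half_angle[OF a 3(1) meet] unfolding good_def ab[symmetric] .
    qed
  qed
  have double_normals_good: "good e f" if e: "e \<in> double_normals" and f: "f \<in> double_normals" and ne: "e \<noteq> f" and adj: "adj e f" for e f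
    using e
  proof (cases rule: double_normals_cases)
    case e: original
    from f show ?thesis
    proof (cases rule: double_normals_cases)
      case original
      then show ?thesis using e ne adj by (intro same)
    next
      case (mirrored b)
      then show ?thesis using e ne adj opposite[of e b] by (simp only: simp_thms)
    qed
  next
    case e: (mirrored a)
    from f show ?thesis
    proof (cases rule: double_normals_cases)
      case original
      have "good f (r a)"
        by (rule opposite[OF original e(1,2)])
          (use ne adj adj_sym[of f "r a"] in \<open>simp_all only: e(3) simp_thms not_sym\<close>)
      then show ?thesis unfolding e(3) by (simp only: good_sym)
    next
      case (mirrored b)
      have "a \<noteq> b"
      proof
        assume "a = b"
        then show False using ne e(3) mirrored(3) by (simp only: simp_thms)
      qed
      moreover have "adj a b" using adj adj_r[of a b] by (simp only: e(3) mirrored(3) simp_thms)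
      ultimately have "good a b" by (rule same[OF e(1,2) mirrored(1,2)])
      then show ?thesis
        by (simp only: good_def e(3) mirrored(3) lorentz_reflection[OF w_unit])
    qed
  qed
  show ?thesis
    unfolding coxeter_polyhedron_iff
  proof (intro conjI hyp_polyhedron_D ballI impI)
    fix e f
    assume e: "e \<in> wall_normals D" and f: "f \<in> wall_normals D" and "e \<noteq> f"
      and "facet D e \<inter> facet D f \<noteq> {}" "Suc (dim (facet D e \<inter> facet D f)) = CARD('n)"
    then have "adj e f"
      unfolding adj_def by (intro conjI)
    with \<open>e \<noteq> f\<close> have "good e f"
      by (rule double_normals_good[OF subsetD[OF wall_normals_D e] subsetD[OF wall_normals_D f]])
    then show "\<exists>m::nat. 2 \<le> m \<and> pi - arccos (lorentz e f) = pi / real m"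
      unfolding good_def .
  qed
qed

section \<open>Disjoint doubling walls of the double\<close>

lemma reflect_wall_normal:
  assumes e: "e \<in> wall_normals D"
  shows "r e \<in> wall_normals D"
proof -
  have "x \<in> halfspace (r e)" if "x \<in> D" for x
  proof -
    have "r x \<in> D" using that by (simp only: reflect_in_D)
    then have "lorentz (r x) e \<le> 0" by (rule wall_normals_nonpos[OF e])
    moreover have "x \<in> hyperbolic_space"
      using that unfolding D_region region_def by (rule IntD1)
    ultimately show ?thesis
      by (simp only: halfspace_def mem_Collect_eq lorentz_reflection_left[OF w_unit] simp_thms)
  qed
  then have "D \<subseteq> halfspace (r e)" by (rule subsetI)
  then show ?thesis
    using e unfolding wall_normals_def mem_Collect_eq facet_reflect_image dim_r_image image_is_empty
      lorentz_reflection[OF w_unit]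
    by (simp only: simp_thms)
qed

lemma doubling_wall_reflect:
  assumes v: "v \<in> wall_normals D"
    and even: "\<And>g. g \<in> wall_normals D \<Longrightarrow> g \<noteq> v \<Longrightarrow> facet D v \<inter> facet D g \<noteq> {} \<Longrightarrow>
      \<exists>m::nat. 0 < m \<and> even m \<and> pi - arccos (lorentz v g) = pi / real m"
  shows "doubling_wall D (facet D (r v))"
  unfolding doubling_wall_iff[OF hyp_polyhedron_D]
proof (intro bexI[of _ "r v"] conjI refl ballI impI reflect_wall_normal v)
  fix g assume g: "g \<in> wall_normals D" "g \<noteq> r v" "facet D (r v) \<inter> facet D g \<noteq> {}"
  have "r g \<noteq> v"
  proof
    assume "r g = v"
    then have "r (r g) = r v" by (rule arg_cong)
    then show False using g(2) by (simp only: reflection_involution[OF w_unit] simp_thms)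
  qed
  moreover have "facet D v \<inter> facet D (r g) \<noteq> {}"
    using g(3) facets_reflect[of "r v" g]
    by (simp only: reflection_involution[OF w_unit] image_is_empty simp_thms)
  ultimately have "\<exists>m::nat. 0 < m \<and> even m \<and> pi - arccos (lorentz v (r g)) = pi / real m"
    by (rule even[OF reflect_wall_normal[OF g(1)]])
  then show "\<exists>m::nat. 0 < m \<and> even m \<and> pi - arccos (lorentz (r v) g) = pi / real m"
    by (simp only: lorentz_reflection_left[OF w_unit])
qed

text \<open>
  As the wall of \<open>v\<close> misses the mirror, it is unchanged in \<open>D\<close>. A wall of \<open>D\<close> meeting it
  does so at a point off the mirror; were its normal a mirrored one \<open>r b\<close>, the hyperplane of \<open>b\<close> would have to be
  perpendicular to the mirror, so that \<open>r b = b\<close> is a normal of \<open>P\<close> anyway. The even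
  angles of \<open>P\<close> along the wall of \<open>v\<close> thus account for all angles of \<open>D\<close> along it.
\<close>

lemma redoublable_D:
  assumes cox: "coxeter_polyhedron P"
    and v: "v \<in> N" "v \<noteq> w" and disj: "facet P w \<inter> facet P v = {}"
    and even: "\<And>f. f \<in> N \<Longrightarrow> f \<noteq> v \<Longrightarrow> facet P v \<inter> facet P f \<noteq> {} \<Longrightarrow>
      \<exists>m::nat. 0 < m \<and> even m \<and> pi - arccos (lorentz v f) = pi / real m"
  shows "redoublable D"
proof -
  have wv: "lorentz w v \<noteq> 0"
    using disjoint_neg[OF v(1) disj] by simp
  have facet_v: "facet D v = facet P v"
  proof (rule set_eqI)
    fix x
    have "x \<in> facet P v" if "x \<in> facet D v"
      using in_facet_D[OF v that] wv by (simp only: simp_thms)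
    moreover have "x \<in> facet D v" if "x \<in> facet P v"
      using that by (simp add: facet_def)
    ultimately show "x \<in> facet D v \<longleftrightarrow> x \<in> facet P v" by (rule iffI)
  qed
  have off_w: "lorentz x w \<noteq> 0" if "x \<in> facet P v" for x
  proof
    assume "lorentz x w = 0"
    then have "x \<in> facet P w \<inter> facet P v" using that by (simp add: facet_def)
    then show False by (simp only: disj empty_iff)
  qed
  have "D \<subseteq> halfspace v"
  proof
    fix x assume x: "x \<in> D"
    then have "x \<in> hyperbolic_space"
      unfolding D_region region_def by (rule IntD1)
    then show "x \<in> halfspace v"
      using D_nonpos[OF x v] by (simp add: halfspace_def)
  qed
  then have vD: "v \<in> wall_normals D"
    using v(1) unfolding wall_normals_def mem_Collect_eq facet_v by (simp only: simp_thms)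
  have even_D: "\<exists>m::nat. 0 < m \<and> even m \<and> pi - arccos (lorentz v g) = pi / real m"
    if g: "g \<in> wall_normals D" "g \<noteq> v" and meet: "facet D v \<inter> facet D g \<noteq> {}" for g
  proof -
    have "\<exists>x. x \<in> facet D v \<inter> facet D g"
      using meet by (simp only: ex_in_conv simp_thms)
    then obtain x where "x \<in> facet D v \<inter> facet D g" by (elim exE)
    then have xv: "x \<in> facet P v" and xg: "lorentz x g = 0"
      unfolding facet_v by (simp_all add: facet_def)
    have xP: "x \<in> P" using xv by (simp add: facet_def)
    have "g \<in> double_normals" using wall_normals_D g(1) by (rule subsetD)
    then have gN: "g \<in> N"
    proof (cases rule: double_normals_cases)
      case (mirrored b)
      then have "lorentz (r x) b = 0"
        using xg by (simp only: lorentz_reflection_left[OF w_unit])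
      then have "lorentz w b = 0"
        using reflected_zero[OF xP mirrored(1,2)] off_w[OF xv] by (simp only: simp_thms)
      then have "r b = b" by (rule reflected_hyperplane)
      then show ?thesis using mirrored by (simp only:)
    qed
    have "x \<in> facet P v \<inter> facet P g"
      using xv xP xg by (simp add: facet_def)
    then have "facet P v \<inter> facet P g \<noteq> {}"
      by (rule ex_in_conv[THEN iffD1, OF exI])
    then show ?thesis by (rule even[OF gN g(2)])
  qed
  have d1: "doubling_wall D (facet D v)"
    unfolding doubling_wall_iff[OF hyp_polyhedron_D]
    by (intro bexI[of _ v] conjI refl ballI impI vD even_D)
  have d2: "doubling_wall D (facet D (r v))"
    using vD even_D by (rule doubling_wall_reflect)
  (* A common point would have its mirror image in P as well, and so would lie on the mirror. *)
  have no_meet: "facet D v \<inter> facet D (r v) = {}"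
  proof (rule ccontr)
    assume "facet D v \<inter> facet D (r v) \<noteq> {}"
    then have "\<exists>x. x \<in> facet D v \<inter> facet D (r v)"
      by (simp only: ex_in_conv simp_thms)
    then obtain x where "x \<in> facet D v \<inter> facet D (r v)" by (elim exE)
    then have x: "x \<in> facet P v" "r x \<in> facet P v"
      unfolding Int_iff facet_reflect facet_v by (rule conjunct1, rule conjunct2)
    then have "x \<in> P" "r x \<in> P" by (simp_all add: facet_def)
    then have "lorentz x w \<le> 0" "lorentz (r x) w \<le> 0"
      by (simp_all only: wall_normals_nonpos[OF w])
    then have "lorentz x w = 0"
      by (simp add: lorentz_reflection_normal[OF w_unit])
    then show False using off_w[OF x(1)] by contradiction
  qed
  have ne: "facet D v \<noteq> facet D (r v)"
  proof
    assume "facet D v = facet D (r v)"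
    with no_meet have "facet D v \<inter> facet D v = {}"
      by (simp only:)
    then have "facet D v = {}" by (simp only: Int_absorb)
    then show False using vD by (simp add: wall_normals_def)
  qed
  show ?thesis
    unfolding redoublable_def meets_def
  proof (rule conjI[OF coxeter_D[OF cox]], rule exI, rule exI, intro conjI)
    show "facet D v \<noteq> facet D (r v)" by (rule ne)
    show "doubling_wall D (facet D v)" "doubling_wall D (facet D (r v))" by (rule d1, rule d2)
    show "\<not> facet D v \<inter> facet D (r v) \<noteq> {}" using no_meet by simp
  qed
qed

end

theorem lemma1p3:
  fixes P w :: "'n::finite lorentz_space set"
  assumes "coxeter_polyhedron P"
    and "doubling_wall P w"
  shows "coxeter_polyhedron (double P w) \<and>
         ((\<exists>v. v \<noteq> w \<and> doubling_wall P v \<and> \<not> meets w v) \<longrightarrow> redoublable (double P w))"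
proof -
  have P: "hyp_polyhedron P"
    using assms(1) by (simp add: coxeter_polyhedron_def)
  obtain e where e: "e \<in> wall_normals P" "w = facet P e"
    and even: "\<forall>f\<in>wall_normals P. f \<noteq> e \<longrightarrow> facet P e \<inter> facet P f \<noteq> {} \<longrightarrow>
      (\<exists>m::nat. 0 < m \<and> even m \<and> pi - arccos (lorentz e f) = pi / real m)"
    using assms(2) unfolding doubling_wall_iff[OF P] by (elim bexE conjE)
  interpret doubled_polyhedron P e
    using P e(1) even by unfold_locales (simp_all only: Ball_def simp_thms)
  have double: "double P w = D"
    unfolding double_def e(2) outward_normal_facet[OF P e(1)] ..
  have "redoublable D" if "\<exists>v. v \<noteq> w \<and> doubling_wall P v \<and> \<not> meets w v"
  proof -
    from that obtain F where F: "F \<noteq> w" "doubling_wall P F" "\<not> meets w F"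
      by (elim exE conjE)
    obtain v where v: "v \<in> wall_normals P" "F = facet P v"
      and even_v: "\<forall>f\<in>wall_normals P. f \<noteq> v \<longrightarrow> facet P v \<inter> facet P f \<noteq> {} \<longrightarrow>
        (\<exists>m::nat. 0 < m \<and> even m \<and> pi - arccos (lorentz v f) = pi / real m)"
      using F(2) unfolding doubling_wall_iff[OF P] by (elim bexE conjE)
    have "v \<noteq> e"
      using F(1) by (simp only: v(2) e(2) facet_eq_iff[OF P v(1) e(1)] simp_thms)
    moreover have "facet P e \<inter> facet P v = {}"
      using F(3) by (simp only: meets_def v(2) e(2) simp_thms)
    ultimately show ?thesis
      using even_v by (intro redoublable_D[OF assms(1) v(1)]) (simp_all only: Ball_def simp_thms)
  qed
  then show ?thesis
    unfolding double using coxeter_D[OF assms(1)] by (intro conjI impI)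
qed

end
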